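(* The class of $(P_1+\overline{P_1+P_3})$-free chordal graphs has bounded clique-width.
   Context: All graphs are finite, simple and undirected. $G$ is $H$-free if it has no induced subgraph isomorphic to $H$. A graph is chordal if it contains no induced cycle $C_r$ with $r\geq 4$. $P_r$ is the path on $r$ vertices, $+$ denotes disjoint union and $\overline{G}$ the complement; $\overline{P_1+P_3}$ is the paw (a triangle with one pendant vertex), so $P_1+\overline{P_1+P_3}$ is the disjoint union of an isolated vertex and a paw. The clique-width of a graph $G$ is the minimum number $k$ of labels needed to construct $G$ using the operations: create a single vertex with label $i$; take the disjoint union of two labelled graphs; add all edges between vertices of label $i$ and vertices of label $j$ ($i\neq j$); rename label $i$ to $j$. A class of graphs has bounded clique-width if there is a constant $c$ such that every graph in the class has clique-width at most $c$. *)

theory Defs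
  imports "Graph_Theory.Pair_Digraph" "Graph_Theory.Digraph_Isomorphism"
begin

text \<open>
  Finite simple undirected graphs are the \<^locale>\<open>pair_graph\<close>s of the AFP entry Graph_Theory:
  finite symmetric loop-free digraphs, an edge uv being the two arcs (u,v) and (v,u).
\<close>

section \<open>Special graphs\<close>

definition path_graph :: "nat \<Rightarrow> nat pair_pre_digraph" where
  "path_graph r = \<lparr> pverts = {..<r},
     parcs = {(i, j). i < r \<and> j < r \<and> (j = Suc i \<or> i = Suc j)} \<rparr>"

text \<open>A simple cycle only for \<open>r \<ge> 3\<close>.\<close>

definition cycle_graph :: "nat \<Rightarrow> nat pair_pre_digraph" where
  "cycle_graph r = \<lparr> pverts = {..<r},
     parcs = {(i, j). i < r \<and> j < r \<and> (j = Suc i mod r \<or> i = Suc j mod r)} \<rparr>"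

definition complement :: "'a pair_pre_digraph \<Rightarrow> 'a pair_pre_digraph" where
  "complement G = \<lparr> pverts = pverts G,
     parcs = {(u, v). u \<in> pverts G \<and> v \<in> pverts G \<and> u \<noteq> v \<and> (u, v) \<notin> parcs G} \<rparr>"

definition disjoint_sum ::
    "'a pair_pre_digraph \<Rightarrow> 'b pair_pre_digraph \<Rightarrow> ('a + 'b) pair_pre_digraph" where
  "disjoint_sum G H = \<lparr> pverts = pverts G <+> pverts H,
     parcs = map_prod Inl Inl ` parcs G \<union> map_prod Inr Inr ` parcs H \<rparr>"

section \<open>Forbidden induced subgraphs\<close>

definition induced_free :: "'b pair_pre_digraph \<Rightarrow> 'a pair_pre_digraph \<Rightarrow> bool" where
  "induced_free H G \<longleftrightarrow>
     \<not> (\<exists>F :: 'a pair_pre_digraph.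
          induced_subgraph (with_proj F) (with_proj G) \<and> digraph_iso (with_proj F) (with_proj H))"

definition chordal :: "'a pair_pre_digraph \<Rightarrow> bool" where
  "chordal G \<longleftrightarrow> (\<forall>r\<ge>4. induced_free (cycle_graph r) G)"

section \<open>Clique-width\<close>

text \<open>
  \<open>cw_constructible k G l\<close>: the graph \<open>G\<close>, with label \<open>l v\<close> on each vertex \<open>v\<close>, can be
  constructed with the labels \<open>0, \<dots>, k - 1\<close>. Values of \<open>l\<close> outside the vertex set are irrelevant.
\<close>

inductive cw_constructible :: "nat \<Rightarrow> 'a pair_pre_digraph \<Rightarrow> ('a \<Rightarrow> nat) \<Rightarrow> bool"
  for k :: nat where
  single: "i < k \<Longrightarrow> cw_constructible k \<lparr> pverts = {v}, parcs = {} \<rparr> (\<lambda>_. i)"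
| disj_union: "\<lbrakk> cw_constructible k G l; cw_constructible k H m; pverts G \<inter> pverts H = {} \<rbrakk> \<Longrightarrow>
    cw_constructible k
      \<lparr> pverts = pverts G \<union> pverts H, parcs = parcs G \<union> parcs H \<rparr>
      (\<lambda>v. if v \<in> pverts G then l v else m v)"
| join: "\<lbrakk> cw_constructible k G l; i < k; j < k; i \<noteq> j \<rbrakk> \<Longrightarrow>
    cw_constructible k
      \<lparr> pverts = pverts G,
        parcs = parcs G \<union> {(u, v). u \<in> pverts G \<and> v \<in> pverts G \<and>
                                (l u = i \<and> l v = j \<or> l u = j \<and> l v = i)} \<rparr> l"
| rename: "\<lbrakk> cw_constructible k G l; i < k; j < k \<rbrakk> \<Longrightarrow>
    cw_constructible k G (\<lambda>v. if l v = i then j else l v)"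

text \<open>
  The operations never produce the graph without vertices; it is given clique-width 0.
  For every other graph the minimum below is attained, see \<open>clique_width_attained\<close>.
\<close>

definition clique_width :: "'a pair_pre_digraph \<Rightarrow> nat" where
  "clique_width G =
     (if pverts G = {} then 0 else (LEAST k. \<exists>l. cw_constructible k G l))"

definition bounded_clique_width :: "'a pair_pre_digraph set \<Rightarrow> bool" where
  "bounded_clique_width \<C> \<longleftrightarrow> (\<exists>c. \<forall>G\<in>\<C>. clique_width G \<le> c)"

section \<open>Basic facts\<close>

lemma edgeless_constructible:
  assumes "finite V" "V \<noteq> {}" "\<And>v. v \<in> V \<Longrightarrow> l v < k"
  shows "\<exists>m. (\<forall>v\<in>V. m v = l v) \<and> cw_constructible k \<lparr> pverts = V, parcs = {} \<rparr> m"
  using assms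
proof (induction V rule: finite_ne_induct)
  case (singleton x)
  then show ?case by (intro exI[of _ "\<lambda>_. l x"]) (auto intro: cw_constructible.single)
next
  case (insert x V)
  then obtain m where m: "\<forall>v\<in>V. m v = l v" "cw_constructible k \<lparr> pverts = V, parcs = {} \<rparr> m"
    by auto
  have "cw_constructible k \<lparr> pverts = {x}, parcs = {} \<rparr> (\<lambda>_. l x)"
    using insert by (intro cw_constructible.single) auto
  from cw_constructible.disj_union[OF this m(2)] insert.hyps m(1) show ?case
    by (intro exI[of _ "\<lambda>v. if v \<in> {x} then l x else m v"]) auto
qed

lemma add_arcs_constructible:
  assumes "finite P" "P \<subseteq> V \<times> V - Id" "inj_on l V" "\<And>v. v \<in> V \<Longrightarrow> l v < k"
    and "cw_constructible k \<lparr> pverts = V, parcs = {} \<rparr> l"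
  shows "cw_constructible k \<lparr> pverts = V, parcs = P \<union> P\<inverse> \<rparr> l"
  using assms
proof (induction P rule: finite_induct)
  case (insert p P)
  obtain x y where p: "p = (x, y)" by fastforce
  have xy: "x \<in> V" "y \<in> V" "x \<noteq> y" using insert.prems p by auto
  then have ne: "l x \<noteq> l y" using insert.prems by (auto dest: inj_onD)
  have "{(u, v). u \<in> V \<and> v \<in> V \<and> (l u = l x \<and> l v = l y \<or> l u = l y \<and> l v = l x)}
      = {(x, y), (y, x)}"
    using xy insert.prems(2) by (auto dest: inj_onD)
  moreover have "cw_constructible k \<lparr> pverts = V, parcs = P \<union> P\<inverse> \<rparr> l"
    using insert by auto
  moreover have "insert p P \<union> (insert p P)\<inverse> = (P \<union> P\<inverse>) \<union> {(x, y), (y, x)}"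
    using p by auto
  ultimately show ?case
    using cw_constructible.join[of k "\<lparr> pverts = V, parcs = P \<union> P\<inverse> \<rparr>" l "l x" "l y"]
      insert.prems(3) xy ne by simp
qed auto

lemma clique_width_attained:
  assumes "pair_graph G" "pverts G \<noteq> {}"
  shows "\<exists>l. cw_constructible (clique_width G) G l"
proof -
  interpret pair_graph G by fact
  have sym: "(parcs G)\<inverse> = parcs G"
    using pair_sym_arcs by (auto simp: symmetric_def dest: symD)
  obtain l :: "'a \<Rightarrow> nat" where l: "inj_on l (pverts G)" "l ` pverts G = {..<card (pverts G)}"
    using ex_bij_betw_finite_nat[OF pair_finite_verts]
    by (auto simp: bij_betw_def atLeast0LessThan)
  then have lt: "\<And>v. v \<in> pverts G \<Longrightarrow> l v < card (pverts G)" by blast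
  obtain m where m: "\<forall>v\<in>pverts G. m v = l v"
      "cw_constructible (card (pverts G)) \<lparr> pverts = pverts G, parcs = {} \<rparr> m"
    using edgeless_constructible[of "pverts G" l "card (pverts G)"] pair_finite_verts assms(2) lt
    by auto
  have "inj_on m (pverts G)" using l(1) m(1) by (simp cong: inj_on_cong)
  moreover have "parcs G \<subseteq> pverts G \<times> pverts G - Id"
    using pair_no_loops by (fastforce dest: in_arcsD1 in_arcsD2)
  ultimately have
    "cw_constructible (card (pverts G)) \<lparr> pverts = pverts G, parcs = parcs G \<union> (parcs G)\<inverse> \<rparr> m"
    using m lt by (intro add_arcs_constructible pair_finite_arcs) auto
  moreover have "\<lparr> pverts = pverts G, parcs = parcs G \<union> (parcs G)\<inverse> \<rparr> = G"
    by (cases G) (use sym in auto)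
  ultimately have "\<exists>l. cw_constructible (card (pverts G)) G l"
    by auto
  then show ?thesis
    unfolding clique_width_def using assms(2) by (auto intro: LeastI)
qed

lemma digraph_iso_with_proj_iff:
  assumes "pair_wf_digraph F" "pair_wf_digraph H"
  shows "digraph_iso (with_proj F) (with_proj H) \<longleftrightarrow>
    (\<exists>f. bij_betw f (pverts F) (pverts H) \<and>
         (\<forall>u\<in>pverts F. \<forall>v\<in>pverts F. (u, v) \<in> parcs F \<longleftrightarrow> (f u, f v) \<in> parcs H))"
    (is "?L \<longleftrightarrow> ?R")
proof
  interpret F: pair_wf_digraph F by fact
  interpret H: pair_wf_digraph H by fact
  {
    assume ?L
    then obtain h where h: "pre_digraph.digraph_isomorphism (with_proj F) h"
      "with_proj H = app_iso h (with_proj F)" by (auto simp: digraph_iso_def)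
    from h(2) have H: "pverts H = iso_verts h ` pverts F" "parcs H = iso_arcs h ` parcs F"
      "iso_tail h = fst" "iso_head h = snd" by (auto simp: app_iso_def with_proj_def)
    from h(1) H have inj: "inj_on (iso_verts h) (pverts F)"
      and ar: "\<And>a. a \<in> parcs F \<Longrightarrow> iso_arcs h a = (iso_verts h (fst a), iso_verts h (snd a))"
      by (auto simp: pre_digraph.digraph_isomorphism_def prod_eq_iff)
    have "(u, v) \<in> parcs F \<longleftrightarrow> (iso_verts h u, iso_verts h v) \<in> parcs H"
      if "u \<in> pverts F" "v \<in> pverts F" for u v
    proof
      assume "(u, v) \<in> parcs F"
      then show "(iso_verts h u, iso_verts h v) \<in> parcs H"
        using ar[of "(u, v)"] unfolding H(2) by (metis fst_conv snd_conv imageI)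
    next
      assume "(iso_verts h u, iso_verts h v) \<in> parcs H"
      then obtain a where a: "a \<in> parcs F" "(iso_verts h u, iso_verts h v) = iso_arcs h a"
        unfolding H(2) by auto
      with ar have "iso_verts h u = iso_verts h (fst a)" "iso_verts h v = iso_verts h (snd a)"
        by auto
      then have "u = fst a" "v = snd a"
        using inj that F.arc_fst_in_verts[OF a(1)] F.arc_snd_in_verts[OF a(1)]
        by (auto dest: inj_onD)
      then show "(u, v) \<in> parcs F" using a by simp
    qed
    with inj H(1) show ?R by (auto simp: bij_betw_def intro!: exI[of _ "iso_verts h"])
  }
  assume ?R
  then obtain f where f: "inj_on f (pverts F)" "f ` pverts F = pverts H"
    "\<forall>u\<in>pverts F. \<forall>v\<in>pverts F. (u, v) \<in> parcs F \<longleftrightarrow> (f u, f v) \<in> parcs H"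
    by (auto simp: bij_betw_def)
  define h where "h = \<lparr> iso_verts = f, iso_arcs = map_prod f f, iso_head = snd, iso_tail = fst \<rparr>"
  have "inj_on (map_prod f f) (parcs F)"
    using f(1) by (intro inj_on_subset[OF map_prod_inj_on[OF f(1) f(1)]])
      (auto dest: F.in_arcsD1 F.in_arcsD2)
  then have "pre_digraph.digraph_isomorphism (with_proj F) h"
    using f(1) F.wf_digraph by (auto simp: pre_digraph.digraph_isomorphism_def h_def)
  moreover have "map_prod f f ` parcs F = parcs H"
  proof (intro equalityI subsetI)
    fix e assume "e \<in> map_prod f f ` parcs F"
    then show "e \<in> parcs H" using f(3) by (auto dest: F.in_arcsD1 F.in_arcsD2)
  next
    fix e assume e: "e \<in> parcs H"
    then obtain x y where xy: "e = (f x, f y)" "x \<in> pverts F" "y \<in> pverts F"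
      using f(2) H.arc_fst_in_verts[OF e] H.arc_snd_in_verts[OF e]
      by (metis imageE prod.collapse)
    with f(3) e have "(x, y) \<in> parcs F" by blast
    then show "e \<in> map_prod f f ` parcs F" using xy(1) by force
  qed
  ultimately show ?L
    unfolding digraph_iso_def using f(2)
    by (intro exI[of _ h]) (auto simp: app_iso_def h_def with_proj_def)
qed

end

theory Submission
  imports Defs
begin

text \<open>
  Let \<open>v\<close> be a simplicial vertex, which every chordal graph has, \<open>K\<close> its neighbourhood, a clique, and
  \<open>R\<close> the set of the other vertices. Since \<open>v\<close> can serve as the isolated vertex of a forbidden
  subgraph, \<open>R\<close> is paw-free, so its components are trees or joins of a clique and an independent set.
  For \<open>k \<in> K\<close> let \<open>M(k)\<close> be the set of the vertices of \<open>R\<close> that \<open>k\<close> misses. The triangles through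
  \<open>v\<close> together with the absence of induced cycles of length 4 and 5 make the sets \<open>M(k)\<close> a laminar
  family, in which disjoint members are anticomplete and a nonempty member is complete to its complement
  in a larger one; hence it is a union of pairwise disjoint chains.

  If four of the sets are pairwise disjoint and nonempty, then all of them are equal or disjoint,
  their union \<open>U\<close> is independent, and the vertices of \<open>R - U\<close> with a neighbour in \<open>U\<close> all have the same
  neighbours there; so \<open>K \<union> U\<close> is a simple block structure joined uniformly to the rest.
  Otherwise, a chain of three nonempty sets produces a triangle and so lives in a component that is a
  join of a clique and an independent set; this component and the members of \<open>K\<close> with a missed vertex
  in it can be built by one linear sweep along the chain and are joined uniformly to the rest.
  Once all these components are removed, at most six distinct nonempty sets remain.

  The constructions use NLC-width, which bounds clique-width up to a constant factor and
  whose only binary operation adds edges between two disjoint graphs according to their labels.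
\<close>

section \<open>NLC-width\<close>

text \<open>
  \<open>E\<close> is the adjacency relation of a fixed ambient graph, and \<open>nlc E k V f\<close> concerns its subgraph
  induced on \<open>V\<close>: the label relation \<open>S\<close> used in a union has to reproduce \<open>E\<close> between the two sides.
\<close>

inductive nlc :: "('a \<Rightarrow> 'a \<Rightarrow> bool) \<Rightarrow> nat \<Rightarrow> 'a set \<Rightarrow> ('a \<Rightarrow> nat) \<Rightarrow> bool"
  for E k where
  single: "f v < k \<Longrightarrow> nlc E k {v} f"
| union: "\<lbrakk> nlc E k A f; nlc E k B g; A \<inter> B = {};
    \<And>u v. \<lbrakk> u \<in> A; v \<in> B \<rbrakk> \<Longrightarrow> E u v \<longleftrightarrow> S (f u) (g v);
    \<And>v. v \<in> A \<Longrightarrow> h v = s (f v); \<And>v. v \<in> B \<Longrightarrow> h v = t (g v);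
    \<And>v. v \<in> A \<union> B \<Longrightarrow> h v < k \<rbrakk> \<Longrightarrow> nlc E k (A \<union> B) h"

lemma nlc_less: "nlc E k V f \<Longrightarrow> v \<in> V \<Longrightarrow> f v < k"
  by (induction arbitrary: v rule: nlc.induct) auto

text \<open>A change of labels is absorbed into the maps \<open>s\<close> and \<open>t\<close> of
  the last union, which is why \<open>nlc\<close> gets by without a relabelling rule.\<close>

lemma nlc_relabel:
  assumes "nlc E k V f" "\<And>v. v \<in> V \<Longrightarrow> h v = s (f v)" "\<And>v. v \<in> V \<Longrightarrow> h v < k"
  shows "nlc E k V h"
  using assms(1)
proof cases
  case (single v)
  then show ?thesis using assms(3) by (auto intro: nlc.single)
next
  case (union A f' B g S p t)
  show ?thesis unfolding union(1)
    using nlc.union[OF union(2-5), of h "s \<circ> p" "s \<circ> t"] union assms(2,3) by auto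
qed

lemma nlc_mono: "nlc E k V f \<Longrightarrow> k \<le> k' \<Longrightarrow> nlc E k' V f"
proof (induction rule: nlc.induct)
  case (single f v)
  then show ?case by (auto intro: nlc.single)
next
  case (union A f B g S h s t)
  show ?case
  proof (rule nlc.union[where f = f and g = g and S = S and s = s and t = t])
    show "h v < k'" if "v \<in> A \<union> B" for v
      using union.hyps(7)[OF that] union.prems by simp
  qed (use union in auto)
qed

text \<open>A mark \<open>c v\<close> can be attached when \<open>v\<close> is created and carried
  through every union: \<open>f v + k * c v\<close> codes the pair of label and mark, and
  \<open>mod k\<close> and \<open>div k\<close> decode it.\<close>

lemma nlc_refine:
  assumes "nlc E k V f" "\<And>v. v \<in> V \<Longrightarrow> c v < m"
  shows "nlc E (k * m) V (\<lambda>v. f v + k * c v)"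
  using assms
proof (induction rule: nlc.induct)
  case (single f v)
  then have "f v + k * c v < k * Suc (c v)" by simp
  also have "\<dots> \<le> k * m" using single(2) by (intro mult_le_mono) (auto simp: Suc_le_eq)
  finally show ?case by (intro nlc.single) auto
next
  case (union A f B g S h s t)
  have lt: "f v < k" if "v \<in> A" for v using nlc_less[OF union(1) that] .
  have lt': "g v < k" if "v \<in> B" for v using nlc_less[OF union(2) that] .
  have bound: "h v + k * c v < k * m" if "v \<in> A \<union> B" for v
  proof -
    have "h v + k * c v < k * Suc (c v)" using union(7)[OF that] by simp
    also have "\<dots> \<le> k * m" using union.prems[OF that] by (intro mult_le_mono) (auto simp: Suc_le_eq)
    finally show ?thesis .
  qed
  show ?case
  proof (rule nlc.union[where f = "\<lambda>v. f v + k * c v" and g = "\<lambda>v. g v + k * c v"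
        and S = "\<lambda>i j. S (i mod k) (j mod k)" and s = "\<lambda>i. s (i mod k) + k * (i div k)"
        and t = "\<lambda>i. t (i mod k) + k * (i div k)"])
    show "nlc E (k * m) A (\<lambda>v. f v + k * c v)" "nlc E (k * m) B (\<lambda>v. g v + k * c v)"
      using union by auto
    show "h v + k * c v = s ((f v + k * c v) mod k) + k * ((f v + k * c v) div k)" if "v \<in> A" for v
      using union(5)[OF that] lt[OF that] by simp
    show "h v + k * c v = t ((g v + k * c v) mod k) + k * ((g v + k * c v) div k)" if "v \<in> B" for v
      using union(6)[OF that] lt'[OF that] by simp
  qed (use union(3,4) lt lt' bound in auto)
qed

section \<open>Width bounds and unions controlled by marks\<close>

definition nlc_width_le :: "('a \<Rightarrow> 'a \<Rightarrow> bool) \<Rightarrow> nat \<Rightarrow> 'a set \<Rightarrow> bool" where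
  "nlc_width_le E k V \<longleftrightarrow> V = {} \<or> (\<exists>f. nlc E k V f)"

lemma nlc_width_le_mono: "nlc_width_le E k V \<Longrightarrow> k \<le> k' \<Longrightarrow> nlc_width_le E k' V"
  unfolding nlc_width_le_def using nlc_mono by metis

lemma nlc_width_leI: "nlc E k V f \<Longrightarrow> nlc_width_le E k V"
  unfolding nlc_width_le_def by blast

text \<open>Carrying the marks along costs the factor \<open>m\<close>; at the end the labels of the
  construction are forgotten and the marks remain.\<close>

lemma nlc_with_marks:
  assumes "nlc_width_le E k V" "V \<noteq> {}" "\<And>v. v \<in> V \<Longrightarrow> c v < m" "k > 0"
  shows "nlc E (k * m) V c"
proof -
  obtain f where f: "nlc E k V f" using assms unfolding nlc_width_le_def by blast
  have "c v < k * m" if "v \<in> V" for v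
    using assms(3)[OF that] assms(4) by (simp add: Suc_leI less_le_trans)
  then show ?thesis
    using nlc_less[OF f] assms(4)
    by (intro nlc_relabel[OF nlc_refine[OF f assms(3)], where s = "\<lambda>i. i div k"]) auto
qed

text \<open>The marks are numbered by a bijection from \<open>C\<close>, so values of any type can
  serve. After the union all labels collapse to 0, since only the width is claimed.\<close>

lemma nlc_width_le_union:
  fixes c :: "'a \<Rightarrow> 'c"
  assumes "nlc_width_le E k A" "nlc_width_le E k B" "A \<inter> B = {}" "k > 0"
    and fin: "finite C" "card C \<le> m" "c ` (A \<union> B) \<subseteq> C"
    and adj: "\<And>u v. \<lbrakk> u \<in> A; v \<in> B \<rbrakk> \<Longrightarrow> E u v \<longleftrightarrow> S (c u) (c v)"
  shows "nlc_width_le E (k * m) (A \<union> B)"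
proof (cases "A = {} \<or> B = {}")
  case True
  show ?thesis
  proof (cases "A \<union> B = {}")
    case False
    with fin have "card C > 0" by (auto simp: card_gt_0_iff)
    with fin have "k \<le> k * m" by simp
    with True assms(1,2) show ?thesis by (auto intro: nlc_width_le_mono)
  qed (simp add: nlc_width_le_def)
next
  case False
  obtain i where i: "bij_betw i C {..<card C}"
    using ex_bij_betw_finite_nat[OF fin(1)] by (auto simp: atLeast0LessThan)
  have lt: "i (c v) < m" if "v \<in> A \<union> B" for v
    using bij_betwE[OF i] that fin by fastforce
  have inv: "inv_into C i (i (c v)) = c v" if "v \<in> A \<union> B" for v
    using bij_betw_inv_into_left[OF i] that fin by blast
  have "nlc E (k * m) A (\<lambda>v. i (c v))" "nlc E (k * m) B (\<lambda>v. i (c v))"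
    using False assms(1,2,4) lt by (auto intro!: nlc_with_marks)
  from nlc.union[OF this assms(3), of "\<lambda>x y. S (inv_into C i x) (inv_into C i y)" "\<lambda>_. 0" "\<lambda>_. 0" "\<lambda>_. 0"]
  have "nlc E (k * m) (A \<union> B) (\<lambda>_. 0)"
    using adj inv False assms(4) lt by fastforce
  then show ?thesis by (rule nlc_width_leI)
qed

text \<open>The relation \<open>S\<close> is not required to be symmetric: the order of the blocks matters.\<close>

lemma nlc_blocks:
  fixes b :: "'a \<Rightarrow> nat"
  assumes "finite V" "V \<noteq> {}"
    and block: "\<And>i. i \<in> b ` V \<Longrightarrow> nlc E k {v \<in> V. b v = i} h"
    and adj: "\<And>u v. \<lbrakk> u \<in> V; v \<in> V; b u < b v \<rbrakk> \<Longrightarrow> E u v \<longleftrightarrow> S (h u) (h v)"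
  shows "nlc E k V h"
proof -
  have lt: "h v < k" if "v \<in> V" for v
    using nlc_less[OF block[of "b v"]] that by auto
  \<comment> \<open>Blocks are appended in increasing order of \<open>b\<close>, so the part built
    so far always supplies the first argument of \<open>S\<close>.\<close>
  have *: "{v \<in> V. b v < n} = {} \<or> nlc E k {v \<in> V. b v < n} h" for n
  proof (induction n)
    case (Suc n)
    have split: "{v \<in> V. b v < Suc n} = {v \<in> V. b v < n} \<union> {v \<in> V. b v = n}"
      by auto
    show ?case
    proof (cases "{v \<in> V. b v = n} = {}")
      case True
      with split have "{v \<in> V. b v < Suc n} = {v \<in> V. b v < n}" by blast
      with Suc show ?thesis by simp
    next
      case False
      then have n: "nlc E k {v \<in> V. b v = n} h" by (intro block) auto
      show ?thesis
      proof (cases "{v \<in> V. b v < n} = {}")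
        case True
        with split have "{v \<in> V. b v < Suc n} = {v \<in> V. b v = n}" by blast
        with n show ?thesis by simp
      next
        case False
        with Suc have "nlc E k {v \<in> V. b v < n} h" by auto
        from this n have "nlc E k ({v \<in> V. b v < n} \<union> {v \<in> V. b v = n}) h"
          by (rule nlc.union[where S = S and s = "\<lambda>i. i" and t = "\<lambda>i. i"]) (use adj lt in auto)
        then show ?thesis unfolding split by blast
      qed
    qed
  qed simp
  have "{v \<in> V. b v < Suc (Max (b ` V))} = V"
    using assms(1) by (auto simp: less_Suc_eq_le)
  with *[of "Suc (Max (b ` V))"] assms(2) show ?thesis by simp
qed

lemma nlc_vertices:
  assumes "finite V" "V \<noteq> {}" "\<And>v. v \<in> V \<Longrightarrow> h v < k"
    and adj: "\<And>u v. \<lbrakk> u \<in> V; v \<in> V; u \<noteq> v \<rbrakk> \<Longrightarrow> E u v \<longleftrightarrow> S (h u) (h v)"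
  shows "nlc E k V h"
proof -
  obtain b :: "'a \<Rightarrow> nat" where b: "inj_on b V"
    using finite_imp_inj_to_nat_seg[OF assms(1)] by blast
  show ?thesis
  proof (rule nlc_blocks[OF assms(1,2), where b = b and S = S])
    fix i assume "i \<in> b ` V"
    then obtain x where x: "x \<in> V" "i = b x" by blast
    then have "{v \<in> V. b v = i} = {x}" using b by (auto dest: inj_onD)
    then show "nlc E k {v \<in> V. b v = i} h" using assms(3)[OF x(1)] by (auto intro: nlc.single)
  qed (use adj in auto)
qed

section \<open>From NLC-constructions to clique-width\<close>

text \<open>The labels in \<open>A\<close> are renamed one at a time. All targets lie outside
  \<open>A\<close>, so a vertex already renamed is never caught by a later renaming.\<close>

lemma cw_rename_set:
  assumes "cw_constructible n G l" "finite A" "A \<subseteq> {..<n}" "t ` A \<subseteq> {..<n} - A"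
  shows "\<exists>m. cw_constructible n G m \<and> (\<forall>v. m v = (if l v \<in> A then t (l v) else l v))"
  using assms(2-)
proof (induction A rule: finite_induct)
  case empty
  then show ?case using assms(1) by auto
next
  case (insert a A)
  then obtain m where m: "cw_constructible n G m" "\<forall>v. m v = (if l v \<in> A then t (l v) else l v)"
    by auto
  have "cw_constructible n G (\<lambda>v. if m v = a then t a else m v)"
    using insert.prems by (intro cw_constructible.rename[OF m(1)]) auto
  moreover have "(if m v = a then t a else m v) = (if l v \<in> insert a A then t (l v) else l v)" for v
    using m(2) insert.prems insert.hyps by auto
  ultimately show ?case by blast
qed

lemma cw_join_set:
  assumes "cw_constructible n G l" "finite P" "P \<subseteq> {..<n} \<times> {..<n} - Id"
  shows "cw_constructible n \<lparr> pverts = pverts G, parcs = parcs G \<union>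
      {(u, v). u \<in> pverts G \<and> v \<in> pverts G \<and> ((l u, l v) \<in> P \<or> (l v, l u) \<in> P)} \<rparr> l"
  using assms(2-)
proof (induction P rule: finite_induct)
  case empty
  then show ?case using assms(1) by (cases G) auto
next
  case (insert p P)
  obtain i j where p: "p = (i, j)" by fastforce
  have eq: "parcs G \<union> {(u, v). u \<in> pverts G \<and> v \<in> pverts G \<and>
      ((l u, l v) \<in> insert p P \<or> (l v, l u) \<in> insert p P)} =
    parcs G \<union> {(u, v). u \<in> pverts G \<and> v \<in> pverts G \<and> ((l u, l v) \<in> P \<or> (l v, l u) \<in> P)}
      \<union> {(u, v). u \<in> pverts G \<and> v \<in> pverts G \<and> (l u = i \<and> l v = j \<or> l u = j \<and> l v = i)}"
    using p by auto
  show ?case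
    unfolding eq
    using cw_constructible.join[of n _ l i j] insert p by fastforce
qed

definition induced :: "('a \<Rightarrow> 'a \<Rightarrow> bool) \<Rightarrow> 'a set \<Rightarrow> 'a pair_pre_digraph" where
  "induced E V = \<lparr> pverts = V, parcs = {(u, v). u \<in> V \<and> v \<in> V \<and> E u v} \<rparr>"

text \<open>
  The labels \<open>0, \<dots>, k - 1\<close> and \<open>k, \<dots>, 2k - 1\<close> keep the two sides of a union apart, the labels
  from \<open>2k\<close> on are used for relabelling by a map that is not injective.
\<close>

lemma nlc_imp_cw_constructible:
  assumes "nlc E k V f" and sym: "\<And>u v. E u v \<Longrightarrow> E v u" and irrefl: "\<And>u. \<not> E u u"
  shows "\<exists>l. cw_constructible (3 * k) (induced E V) l \<and> (\<forall>v\<in>V. l v = f v)"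
  using assms(1)
proof (induction rule: nlc.induct)
  case (single f v)
  then have "cw_constructible (3 * k) \<lparr> pverts = {v}, parcs = {} \<rparr> (\<lambda>_. f v)"
    by (intro cw_constructible.single) simp
  moreover have "\<lparr> pverts = {v}, parcs = {} \<rparr> = induced E {v}"
    using irrefl by (auto simp: induced_def)
  ultimately show ?case by auto
next
  case (union A f B g S h s t)
  note f_lt = nlc_less[OF union.hyps(1)] and g_lt = nlc_less[OF union.hyps(2)]
  obtain l where l: "cw_constructible (3 * k) (induced E A) l" "\<forall>v\<in>A. l v = f v"
    using union.IH by blast
  obtain m where m: "cw_constructible (3 * k) (induced E B) m" "\<forall>v\<in>B. m v = g v"
    using union.IH by blast
  obtain m' where m': "cw_constructible (3 * k) (induced E B) m'" "\<forall>v\<in>B. m' v = k + g v"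
    using cw_rename_set[OF m(1), of "{..<k}" "\<lambda>i. k + i"] m(2) g_lt by fastforce
  define F where "F = \<lparr> pverts = A \<union> B,
    parcs = parcs (induced E A) \<union> parcs (induced E B) \<rparr>"
  define q where "q v = (if v \<in> A then l v else m' v)" for v
  have "cw_constructible (3 * k) F q"
    using cw_constructible.disj_union[OF l(1) m'(1)] union.hyps(3)
    by (simp add: F_def q_def[abs_def] induced_def)
  moreover define P where "P = {(i, k + j) | i j. i < k \<and> j < k \<and> S i j}"
  moreover have "finite P"
    by (rule finite_subset[of _ "{..<2*k} \<times> {..<2*k}"]) (auto simp: P_def)
  ultimately have "cw_constructible (3 * k) \<lparr> pverts = pverts F, parcs = parcs F \<union>
      {(u, v). u \<in> pverts F \<and> v \<in> pverts F \<and> ((q u, q v) \<in> P \<or> (q v, q u) \<in> P)} \<rparr> q"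
    by (intro cw_join_set) (auto simp: P_def)
  moreover have "\<lparr> pverts = pverts F, parcs = parcs F \<union>
      {(u, v). u \<in> pverts F \<and> v \<in> pverts F \<and> ((q u, q v) \<in> P \<or> (q v, q u) \<in> P)} \<rparr> =
    induced E (A \<union> B)"
  proof -
    have qA: "q v = f v" "q v < k" if "v \<in> A" for v
      using that l(2) f_lt by (auto simp: q_def)
    have qB: "q v = k + g v" "g v < k" if "v \<in> B" for v
      using that m'(2) g_lt union.hyps(3) by (auto simp: q_def)
    have 1: "(q u, q v) \<in> P \<longleftrightarrow> u \<in> A \<and> v \<in> B \<and> E u v" if "u \<in> A \<union> B" "v \<in> A \<union> B" for u v
      using that qA[of u] qA[of v] qB[of u] qB[of v] union.hyps(4)[of u v] by (auto simp: P_def)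
    have "{(u, v). u \<in> A \<union> B \<and> v \<in> A \<union> B \<and> ((q u, q v) \<in> P \<or> (q v, q u) \<in> P)} =
      {(u, v). u \<in> A \<and> v \<in> B \<and> E u v \<or> u \<in> B \<and> v \<in> A \<and> E u v}"
      using 1 sym by blast
    then show ?thesis by (auto simp: F_def induced_def)
  qed
  ultimately have q: "cw_constructible (3 * k) (induced E (A \<union> B)) q" by simp
  \<comment> \<open>The \<open>mod k\<close> keeps the targets below \<open>3 * k\<close> even where
    \<open>s\<close> or \<open>t\<close> takes large values; on labels that occur it changes
    nothing, because \<open>h v < k\<close>.\<close>
  obtain q' where q': "cw_constructible (3 * k) (induced E (A \<union> B)) q'"
    "\<forall>v. q' v = (if q v \<in> {..<2*k} then 2 * k + (if q v < k then s (q v) else t (q v - k)) mod k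
       else q v)"
    using cw_rename_set[OF q, of "{..<2*k}"
        "\<lambda>i. 2 * k + (if i < k then s i else t (i - k)) mod k"]
    by (fastforce intro: mod_less_divisor)
  have q'h: "q' v = 2 * k + h v" if "v \<in> A \<union> B" for v
  proof (cases "v \<in> A")
    case True
    then show ?thesis
      using q'(2) l(2) f_lt[OF True] union.hyps(5)[OF True] union.hyps(7)[of v] by (simp add: q_def)
  next
    case False
    with that have v: "v \<in> B" by simp
    with False show ?thesis
      using q'(2) m'(2) g_lt[OF v] union.hyps(6)[OF v] union.hyps(7)[of v] by (simp add: q_def)
  qed
  obtain r where r: "cw_constructible (3 * k) (induced E (A \<union> B)) r"
    "\<forall>v. r v = (if q' v \<in> {2*k..<3*k} then q' v - 2 * k else q' v)"
    using cw_rename_set[OF q'(1), of "{2*k..<3*k}" "\<lambda>i. i - 2 * k"] by fastforce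
  have "r v = h v" if "v \<in> A \<union> B" for v
    unfolding r(2)[rule_format] q'h[OF that] using union.hyps(7)[OF that] by simp
  with r(1) show ?case by blast
qed

section \<open>Induced paths and holes\<close>

lemma not_induced_free:
  assumes "pair_graph G" "pair_wf_digraph H"
    and inj: "inj_on g (pverts H)" and sub: "g ` pverts H \<subseteq> pverts G"
    and arcs: "\<And>u v. \<lbrakk> u \<in> pverts H; v \<in> pverts H \<rbrakk> \<Longrightarrow> (u, v) \<in> parcs H \<longleftrightarrow> (g u, g v) \<in> parcs G"
  shows "\<not> induced_free H G"
proof -
  interpret G: pair_graph G by fact
  define F where "F = \<lparr> pverts = g ` pverts H,
    parcs = {(u, v). u \<in> g ` pverts H \<and> v \<in> g ` pverts H \<and> (u, v) \<in> parcs G} \<rparr>"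
  have wf: "pair_wf_digraph F" by unfold_locales (auto simp: F_def)
  have "induced_subgraph (with_proj F) (with_proj G)"
    unfolding induced_subgraph_def subgraph_def compatible_def
    using sub wf wf_digraph_wp_iff[of F] G.wf_digraph
    by (auto simp: F_def with_proj_def)
  moreover have "digraph_iso (with_proj F) (with_proj H)"
    unfolding digraph_iso_with_proj_iff[OF wf assms(2)]
  proof (intro exI conjI ballI)
    show "bij_betw (inv_into (pverts H) g) (pverts F) (pverts H)"
      using inj by (simp add: F_def bij_betw_inv_into inj_on_imp_bij_betw)
    fix u v assume "u \<in> pverts F" "v \<in> pverts F"
    then obtain x y where "u = g x" "v = g y" "x \<in> pverts H" "y \<in> pverts H"
      by (auto simp: F_def)
    then show "(u, v) \<in> parcs F \<longleftrightarrow>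
        (inv_into (pverts H) g u, inv_into (pverts H) g v) \<in> parcs H"
      using arcs inj by (auto simp: F_def)
  qed
  ultimately show ?thesis unfolding induced_free_def by blast
qed

fun induced_path :: "('a \<Rightarrow> 'a \<Rightarrow> bool) \<Rightarrow> 'a list \<Rightarrow> bool" where
  "induced_path E [] \<longleftrightarrow> True"
| "induced_path E [x] \<longleftrightarrow> True"
| "induced_path E (x # y # p) \<longleftrightarrow>
     E x y \<and> x \<notin> set (y # p) \<and> (\<forall>z\<in>set p. \<not> E x z) \<and> induced_path E (y # p)"

lemma induced_path_Cons:
  "induced_path E (x # p) \<Longrightarrow> induced_path E p"
  by (cases p) auto

lemma induced_path_append_right: "induced_path E (p @ q) \<Longrightarrow> induced_path E q"
  by (induction p) (auto dest: induced_path_Cons)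

lemma induced_path_append_left: "induced_path E (p @ q) \<Longrightarrow> induced_path E p"
  by (induction E p rule: induced_path.induct) auto

lemma induced_path_distinct: "induced_path E p \<Longrightarrow> distinct p"
  by (induction E p rule: induced_path.induct) auto

text \<open>As a reflexive closure it contains \<open>(x, x)\<close> even for \<open>x\<close>
  outside \<open>D\<close>; later lemmas therefore ask for membership in \<open>D\<close>
  separately.\<close>

definition conn :: "('a \<Rightarrow> 'a \<Rightarrow> bool) \<Rightarrow> 'a set \<Rightarrow> ('a \<times> 'a) set" where
  "conn E D = {(x, y). x \<in> D \<and> y \<in> D \<and> E x y}\<^sup>*"

lemma conn_refl [simp]: "(x, x) \<in> conn E D"
  by (simp add: conn_def)

lemma conn_step: "\<lbrakk> (x, y) \<in> conn E D; y \<in> D; z \<in> D; E y z \<rbrakk> \<Longrightarrow> (x, z) \<in> conn E D"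
  unfolding conn_def by (rule rtrancl_into_rtrancl) auto

lemma conn_trans: "\<lbrakk> (x, y) \<in> conn E D; (y, z) \<in> conn E D \<rbrakk> \<Longrightarrow> (x, z) \<in> conn E D"
  unfolding conn_def by (rule rtrancl_trans)

lemma conn_mono: "(x, y) \<in> conn E D \<Longrightarrow> D \<subseteq> D' \<Longrightarrow> (x, y) \<in> conn E D'"
  unfolding conn_def by (erule rtrancl_mono[THEN subsetD, rotated]) auto

lemma conn_induct [consumes 1, case_names refl step]:
  assumes "(x, y) \<in> conn E D" "P x"
    "\<And>y z. \<lbrakk> (x, y) \<in> conn E D; P y; y \<in> D; z \<in> D; E y z \<rbrakk> \<Longrightarrow> P z"
  shows "P y"
  using assms(1) unfolding conn_def
  by (induction rule: rtrancl_induct) (use assms(2,3) in \<open>auto simp: conn_def\<close>)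

text \<open>Vertices are prepended one by one. If the new vertex \<open>x\<close> is already on the
  path, the path is cut there; otherwise everything before the last neighbour of \<open>x\<close> is
  dropped, so that no chord arises.\<close>

lemma induced_path_exists:
  assumes "(s, t) \<in> conn E D" "t \<in> D"
  shows "\<exists>p. induced_path E p \<and> p \<noteq> [] \<and> hd p = s \<and> last p = t \<and> set p \<subseteq> D"
  using assms(1) unfolding conn_def
proof (induction rule: converse_rtrancl_induct)
  case base
  then show ?case using assms(2) by (intro exI[of _ "[t]"]) auto
next
  case (step x y)
  then obtain p where p: "induced_path E p" "p \<noteq> []" "hd p = y" "last p = t" "set p \<subseteq> D" by blast
  have xy: "x \<in> D" "E x y" using step by auto
  show ?case
  proof (cases "x \<in> set p")
    case True
    then obtain as bs where "p = as @ x # bs" by (auto dest: split_list)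
    then show ?thesis
      using p by (intro exI[of _ "x # bs"]) (auto dest: induced_path_append_right)
  next
    case False
    have "\<exists>z\<in>set p. E x z" using p xy hd_in_set by metis
    then obtain as w bs where w: "p = as @ w # bs" "E x w" "\<forall>z\<in>set bs. \<not> E x z"
      using split_list_last_prop[of p "E x"] by blast
    have "induced_path E (w # bs)" using p(1) w(1) induced_path_append_right by blast
    then show ?thesis
      using p w False xy by (intro exI[of _ "x # w # bs"]) auto
  qed
qed

text \<open>A hole is presented as a vertex \<open>x\<close> and an induced path between its two
  neighbours \<open>a\<close> and \<open>b\<close> on it, whose interior \<open>p\<close> is
  nonempty and contains no neighbour of \<open>x\<close>; its length is at least 4.\<close>

locale hole_free =
  fixes E :: "'a \<Rightarrow> 'a \<Rightarrow> bool"
  assumes sym: "E u v \<Longrightarrow> E v u" and irrefl [simp]: "\<not> E u u"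
    and no_hole: "\<lbrakk> induced_path E (a # p @ [b]); p \<noteq> []; E x a; E x b;
      \<And>z. z \<in> set p \<Longrightarrow> z \<noteq> x \<and> \<not> E x z \<rbrakk> \<Longrightarrow> False"
begin

lemma no_C4: "\<lbrakk> E a b; E b c; E c d; E d a; \<not> E a c; \<not> E b d; a \<noteq> c; b \<noteq> d \<rbrakk> \<Longrightarrow> False"
  using no_hole[of b "[c]" d a] sym irrefl by fastforce

lemma no_C5:
  "\<lbrakk> E a b; E b c; E c d; E d e; E e a; \<not> E a c; \<not> E a d; \<not> E b d; \<not> E b e; \<not> E c e;
    a \<noteq> c; a \<noteq> d; b \<noteq> d; b \<noteq> e; c \<noteq> e \<rbrakk> \<Longrightarrow> False"
  using no_hole[of b "[c, d]" e a] sym irrefl by fastforce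

lemma conn_sym: "(x, y) \<in> conn E D \<Longrightarrow> (y, x) \<in> conn E D"
proof (induction rule: conn_induct)
  case (step y z)
  have "(z, y) \<in> conn E D" using conn_step[OF conn_refl, of z D y] step sym by blast
  then show ?case using step conn_trans by metis
qed simp

lemma conn_component:
  assumes "(x, y) \<in> conn E D" "x \<in> D"
  shows "(x, y) \<in> conn E {z \<in> D. (x, z) \<in> conn E D}"
  using assms(1)
proof (induction rule: conn_induct)
  case (step y z)
  have "(x, z) \<in> conn E D" using step conn_step by metis
  then show ?case using step by (auto intro: conn_step[of _ y])
qed simp

subsection \<open>Simplicial vertices\<close>

definition simplicial :: "'a set \<Rightarrow> 'a \<Rightarrow> bool" where
  "simplicial W z \<longleftrightarrow> z \<in> W \<and> (\<forall>a\<in>W. \<forall>b\<in>W. E z a \<longrightarrow> E z b \<longrightarrow> a \<noteq> b \<longrightarrow> E a b)"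

text \<open>Dirac's theorem on simplicial vertices, with a non-neighbour of \<open>x\<close>
  demanded so that the induction works. The component \<open>C\<close> of \<open>y\<close> among the
  non-neighbours of \<open>x\<close> is attached to the rest of \<open>W\<close> only through
  \<open>S\<close>, so the induction hypothesis is applied to \<open>C \<union> S\<close>.\<close>

lemma ex_simplicial_nonneighbour:
  assumes "finite W" "x \<in> W" "y \<in> W" "y \<noteq> x" "\<not> E x y"
  shows "\<exists>z. simplicial W z \<and> z \<noteq> x \<and> \<not> E x z"
  using assms
proof (induction W arbitrary: x y rule: finite_psubset_induct)
  case (psubset W)
  define D where "D = {z \<in> W. z \<noteq> x \<and> \<not> E x z}"
  define C where "C = {z \<in> D. (y, z) \<in> conn E D}"
  define S where "S = {s \<in> W. E x s \<and> (\<exists>c\<in>C. E s c)}"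
  have yD: "y \<in> D" using psubset.prems by (simp add: D_def)
  then have yC: "y \<in> C" by (simp add: C_def)
  have conn_C: "(c, c') \<in> conn E C" if "c \<in> C" "c' \<in> C" for c c'
  proof -
    have "(y, c) \<in> conn E C" "(y, c') \<in> conn E C"
      using that conn_component[OF _ yD, of c] conn_component[OF _ yD, of c'] by (auto simp: C_def)
    then show ?thesis by (metis conn_sym conn_trans)
  qed
  have closed: "w \<in> C \<union> S" if "c \<in> C" "w \<in> W" "E c w" for c w
  proof (cases "E x w")
    case True
    then show ?thesis using that sym by (auto simp: S_def)
  next
    case False
    then have "w \<in> D" using that sym by (auto simp: D_def C_def)
    then show ?thesis using that conn_step[of y c E D w] by (auto simp: C_def)
  qed
  \<comment> \<open>An induced path from \<open>s\<close> to \<open>s'\<close> through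
    \<open>C\<close> would form a hole with \<open>x\<close>.\<close>
  have clique: "E s s'" if s: "s \<in> S" "s' \<in> S" "s \<noteq> s'" for s s'
  proof (rule ccontr)
    assume ns: "\<not> E s s'"
    let ?D = "C \<union> {s, s'}"
    obtain c c' where c: "c \<in> C" "c' \<in> C" "E s c" "E s' c'" using s by (auto simp: S_def)
    have "(s, c) \<in> conn E ?D" using conn_step[OF conn_refl, of s ?D c E] c by auto
    moreover have "(c, c') \<in> conn E ?D" using conn_C[OF c(1,2)] by (rule conn_mono) auto
    ultimately have "(s, s') \<in> conn E ?D"
      using c sym by (intro conn_step[of s c' E ?D s']) (auto intro: conn_trans)
    then obtain p where p: "induced_path E p" "p \<noteq> []" "hd p = s" "last p = s'" "set p \<subseteq> ?D"
      using induced_path_exists[of s s' E ?D] by auto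
    obtain q where q: "p = s # q @ [s']"
      using p s(3) by (metis append_butlast_last_id hd_append2 last.simps list.collapse list.sel(1))
    have "q \<noteq> []" using p(1) q ns by auto
    moreover have "set q \<subseteq> C" using p(5) q induced_path_distinct[OF p(1)] by auto
    ultimately show False
      using no_hole[of s q s' x] p(1) q s(1,2) by (auto simp: S_def C_def D_def)
  qed
  have sub: "C \<union> S \<subset> W" using psubset.prems by (auto simp: C_def D_def S_def)
  \<comment> \<open>All neighbours in \<open>W\<close> of a vertex of \<open>C\<close> lie in
    \<open>C \<union> S\<close>.\<close>
  have extend: "simplicial W z" if "simplicial (C \<union> S) z" "z \<in> C" for z
    using that closed sub unfolding simplicial_def by blast
  have nonnbr: "z \<noteq> x \<and> \<not> E x z" if "z \<in> C" for z using that by (auto simp: C_def D_def)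
  show ?case
  proof (cases "\<forall>a\<in>C \<union> S. \<forall>b\<in>C \<union> S. a \<noteq> b \<longrightarrow> E a b")
    case True
    then have "simplicial (C \<union> S) y" using yC by (auto simp: simplicial_def)
    then show ?thesis using extend nonnbr yC by blast
  next
    case False
    \<comment> \<open>The vertex \<open>a\<close> is chosen to see every other vertex of
      \<open>S\<close>; a simplicial vertex that \<open>a\<close> does not see must then lie in
      \<open>C\<close>.\<close>
    have "\<exists>a\<in>C \<union> S. \<exists>b\<in>C \<union> S. b \<noteq> a \<and> \<not> E a b \<and> (a \<in> S \<or> (\<forall>s\<in>S. E a s))"
    proof (cases "\<exists>s\<in>S. \<exists>b\<in>C \<union> S. b \<noteq> s \<and> \<not> E s b")
      case True
      then show ?thesis by blast
    next
      case F: False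
      obtain a b where ab: "a \<in> C \<union> S" "b \<in> C \<union> S" "a \<noteq> b" "\<not> E a b" using False by blast
      have F': "E s b" if "s \<in> S" "b \<in> C \<union> S" "b \<noteq> s" for s b using F that by metis
      have "a \<notin> S" using F' ab by metis
      moreover have "E a s" if "s \<in> S" for s
        using F'[OF that ab(1)] that \<open>a \<notin> S\<close> sym by metis
      ultimately show ?thesis using ab by (intro bexI[of _ a] bexI[of _ b]) auto
    qed
    then obtain a b where ab: "a \<in> C \<union> S" "b \<in> C \<union> S" "b \<noteq> a" "\<not> E a b"
      "a \<in> S \<or> (\<forall>s\<in>S. E a s)" by blast
    obtain z where z: "simplicial (C \<union> S) z" "z \<noteq> a" "\<not> E a z"
      using psubset.IH[OF sub ab(1,2,3,4)] by blast
    then have "z \<in> C" using ab(5) clique unfolding simplicial_def by blast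
    then show ?thesis using z extend nonnbr by blast
  qed
qed

lemma ex_simplicial:
  assumes "finite W" "W \<noteq> {}"
  shows "\<exists>z. simplicial W z"
proof (cases "\<exists>x\<in>W. \<exists>y\<in>W. y \<noteq> x \<and> \<not> E x y")
  case True
  then show ?thesis using ex_simplicial_nonneighbour[OF assms(1)] by blast
next
  case False
  then have "E a b" if "a \<in> W" "b \<in> W" "a \<noteq> b" for a b
    using that by metis
  moreover obtain x where "x \<in> W" using assms(2) by blast
  ultimately show ?thesis by (auto simp: simplicial_def)
qed

section \<open>Paw-free chordal graphs\<close>

text \<open>Without holes and triangles the graph is a forest. Label 1 marks the root
  \<open>r\<close>. If \<open>r\<close> has a neighbour \<open>c\<close>, the branch
  \<open>D\<close> containing \<open>c\<close> is split off: \<open>r c\<close> is the only edge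
  between \<open>D\<close> and the rest.\<close>

lemma forest_nlc:
  assumes "finite W" "r \<in> W"
    and "\<And>a b c. \<lbrakk> a \<in> W; b \<in> W; c \<in> W; E a b; E b c \<rbrakk> \<Longrightarrow> \<not> E a c"
  shows "nlc E 2 W (\<lambda>v. if v = r then 1 else 0)"
  using assms
proof (induction W arbitrary: r rule: finite_psubset_induct)
  case (psubset W)
  show ?case
  proof (cases "\<exists>c\<in>W. E r c")
    case True
    then obtain c where c: "c \<in> W" "E r c" by blast
    define W' where "W' = W - {r}"
    define D where "D = {z \<in> W'. (c, z) \<in> conn E W'}"
    have cW': "c \<in> W'" using c by (auto simp: W'_def)
    then have cD: "c \<in> D" by (simp add: D_def)
    have DW: "D \<subset> W" "W - D \<subset> W" using psubset.prems c(1) cD by (auto simp: D_def W'_def)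
    \<comment> \<open>On an induced path from \<open>c\<close> to another neighbour \<open>w\<close>
      of \<open>r\<close>, the first neighbour of \<open>r\<close> after \<open>c\<close> closes a
      triangle or a hole with \<open>r\<close>.\<close>
    have unique: "w = c" if w: "w \<in> D" "E r w" for w
    proof (rule ccontr)
      assume ne: "w \<noteq> c"
      obtain p where p: "induced_path E p" "p \<noteq> []" "hd p = c" "last p = w" "set p \<subseteq> W'"
        using induced_path_exists[of c w E W'] w by (auto simp: D_def)
      obtain q where q: "p = c # q" using p by (cases p) auto
      with ne p(4) have "w \<in> set q" by (auto split: if_splits)
      with w(2) have "\<exists>z\<in>set q. E r z" by blast
      then obtain as z bs where z: "q = as @ z # bs" "E r z" "\<forall>u\<in>set as. \<not> E r u"
        using split_list_first_prop[of q "E r"] by blast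
      have path: "induced_path E (c # as @ [z])"
        using induced_path_append_left[of E "c # as @ [z]" bs] p(1) q z(1) by simp
      have sub: "set as \<subseteq> W'" "z \<in> W'" using p(5) q z(1) by auto
      show False
      proof (cases "as = []")
        case True
        then show False
          using path psubset.prems(2)[of r c z] z(2) c sub psubset.prems(1) by (auto simp: W'_def)
      next
        case False
        then show False using no_hole[OF path, of r] c z(2,3) sub by (auto simp: W'_def)
      qed
    qed
    have adj: "E u v \<longleftrightarrow> u = r \<and> v = c" if "u \<in> W - D" "v \<in> D" for u v
    proof
      assume uv: "E u v"
      have "u = r"
      proof (rule ccontr)
        assume "u \<noteq> r"
        then have "u \<in> W'" using that by (auto simp: W'_def)
        then have "u \<in> D" using that uv conn_step[of c v E W' u] sym by (auto simp: D_def)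
        with that show False by blast
      qed
      with uv unique that show "u = r \<and> v = c" by blast
    qed (use c in auto)
    have "nlc E 2 (W - D) (\<lambda>v. if v = r then 1 else 0)"
      by (rule psubset.IH) (use DW psubset.prems in \<open>auto simp: D_def W'_def\<close>)
    moreover have "nlc E 2 D (\<lambda>v. if v = c then 1 else 0)"
      by (rule psubset.IH) (use DW cD psubset.prems(2) in \<open>auto simp: D_def W'_def\<close>)
    ultimately have "nlc E 2 ((W - D) \<union> D) (\<lambda>v. if v = r then 1 else 0)"
      by (rule nlc.union[where S = "\<lambda>i j. i = 1 \<and> j = 1" and s = "\<lambda>i. i" and t = "\<lambda>_. 0"])
        (use adj in \<open>auto simp: D_def W'_def\<close>)
    moreover have "(W - D) \<union> D = W" using DW by blast
    ultimately show ?thesis by simp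
  next
    case False
    have single: "nlc E 2 {r} (\<lambda>v. if v = r then 1 else 0)" by (rule nlc.single) simp
    show ?thesis
    proof (cases "W = {r}")
      case True
      then show ?thesis using single by simp
    next
      case ne: False
      \<comment> \<open>Here \<open>r\<close> is isolated, so any other vertex can be the root of
        what remains.\<close>
      then obtain r' where r': "r' \<in> W - {r}" using psubset.prems(1) by blast
      have "nlc E 2 (W - {r}) (\<lambda>v. if v = r' then 1 else 0)"
        by (rule psubset.IH) (use r' psubset.prems in auto)
      with single have "nlc E 2 ({r} \<union> (W - {r})) (\<lambda>v. if v = r then 1 else 0)"
        by (rule nlc.union[where S = "\<lambda>_ _. False" and s = "\<lambda>i. i" and t = "\<lambda>_. 0"])
          (use False in auto)
      moreover have "{r} \<union> (W - {r}) = W" using psubset.prems by blast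
      ultimately show ?thesis by simp
    qed
  qed
qed

text \<open>In the excluded paw \<open>c\<close> has degree 3, \<open>x\<close> is the pendant
  vertex, and \<open>y\<close> and \<open>z\<close> complete the triangle.\<close>

definition paw_free :: "'a set \<Rightarrow> bool" where
  "paw_free R \<longleftrightarrow> (\<forall>c\<in>R. \<forall>x\<in>R. \<forall>y\<in>R. \<forall>z\<in>R.
     E c x \<longrightarrow> E c y \<longrightarrow> E c z \<longrightarrow> E y z \<longrightarrow> E x y \<or> E x z \<or> x = y \<or> x = z)"

lemma paw_freeD:
  "\<lbrakk> paw_free R; E c x; E c y; E c z; E y z; c \<in> R; x \<in> R; y \<in> R; z \<in> R \<rbrakk>
    \<Longrightarrow> E x y \<or> E x z \<or> x = y \<or> x = z"
  unfolding paw_free_def by blast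

lemma paw_free_subset: "paw_free R \<Longrightarrow> R' \<subseteq> R \<Longrightarrow> paw_free R'"
  unfolding paw_free_def by blast

section \<open>Components of a paw-free graph that contain a triangle\<close>

context
  fixes R C :: "'a set" and o1 o2 o3 :: 'a
  assumes pf: "paw_free R" and o_in: "o1 \<in> R" "o2 \<in> R" "o3 \<in> R"
    and tri: "E o1 o2" "E o1 o3" "E o2 o3"
    and C: "C = {z \<in> R. (o1, z) \<in> conn E R}"
begin

text \<open>Lying in a triangle spreads along edges: a neighbour \<open>w\<close> of
  \<open>z\<close> that neither sees nor equals one of \<open>p\<close>, \<open>q\<close> would be
  the pendant vertex of a paw.\<close>

lemma comp_vertex_in_triangle:
  assumes "z \<in> C"
  shows "\<exists>p\<in>R. \<exists>q\<in>R. E z p \<and> E z q \<and> E p q"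
proof -
  have "(o1, z) \<in> conn E R" using assms C by simp
  then show ?thesis
  proof (induction rule: conn_induct)
    case refl
    then show ?case using tri o_in by blast
  next
    case (step z w)
    then obtain p q where pq: "p \<in> R" "q \<in> R" "E z p" "E z q" "E p q" by blast
    have "E w p \<or> E w q \<or> w = p \<or> w = q"
      using paw_freeD[OF pf, of z w p q] step pq by blast
    then show ?case using pq step sym by metis
  qed
qed

lemma comp_edge_in_triangle:
  assumes "a \<in> C" "b \<in> R" "E a b"
  shows "\<exists>t\<in>R. E a t \<and> E b t"
proof -
  obtain p q where pq: "p \<in> R" "q \<in> R" "E a p" "E a q" "E p q"
    using comp_vertex_in_triangle[OF assms(1)] by blast
  have "a \<in> R" using assms(1) C by simp
  then have "E b p \<or> E b q \<or> b = p \<or> b = q"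
    using paw_freeD[OF pf, of a b p q] pq assms by blast
  then show ?thesis using pq sym by metis
qed

text \<open>The claim is propagated along a path starting at \<open>a\<close>, with the help of a
  common neighbour \<open>t\<close> of \<open>a\<close> and \<open>b\<close>.\<close>

lemma comp_edge_dominates:
  assumes ab: "a \<in> C" "b \<in> C" "E a b" and w: "w \<in> C"
  shows "w = a \<or> w = b \<or> E w a \<or> E w b"
proof -
  have R: "a \<in> R" "b \<in> R" using ab C by auto
  have "(o1, a) \<in> conn E R" "(o1, w) \<in> conn E R" using ab w C by auto
  then have "(a, w) \<in> conn E R" by (metis conn_sym conn_trans)
  obtain t where t: "t \<in> R" "E a t" "E b t" using comp_edge_in_triangle ab R by blast
  from \<open>(a, w) \<in> conn E R\<close> show ?thesis
  proof (induction rule: conn_induct)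
    case refl
    then show ?case by simp
  next
    case (step e d)
    \<comment> \<open>The main case is that \<open>e\<close> sees \<open>x\<close> but not
      \<open>y\<close>: the triangle \<open>x y t\<close> forces \<open>e\<close> to see
      \<open>t\<close>, the triangle \<open>e x t\<close> forces \<open>d\<close> to touch
      \<open>x\<close> or \<open>t\<close>, and from \<open>t\<close> the triangle
      \<open>t x y\<close> leads back to \<open>x\<close> or \<open>y\<close>.\<close>
    have aux: "E d x \<or> E d y \<or> d = x \<or> d = y"
      if "E e x" "E x y" "E x t" "E y t" "x \<in> R" "y \<in> R" for x y
    proof (cases "E e y")
      case True
      then show ?thesis using paw_freeD[OF pf, of e d x y] step that by blast
    next
      case False
      show ?thesis
      proof (cases "e = y")
        case True
        then show ?thesis using step sym by blast
      next
        case ne: False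
        have "E e t \<or> e = t"
          using paw_freeD[OF pf, of x e y t] that False ne step t sym by blast
        then have et: "E e t" using False sym that by blast
        then have "E d x \<or> E d t \<or> d = x \<or> d = t"
          using paw_freeD[OF pf, of e d x t] step that t by blast
        then show ?thesis
          using paw_freeD[OF pf, of t d x y] step that t sym by blast
      qed
    qed
    from step.IH show ?case
      using aux[of a b] aux[of b a] sym ab(3) t R step by blast
  qed
qed

text \<open>Unless \<open>C\<close> is a clique, let \<open>I\<close> be the set of the vertices of
  \<open>C\<close> that some \<open>p\<close> with a non-neighbour \<open>q\<close> does not see. An
  edge inside \<open>I\<close> would not dominate \<open>p\<close>; a missing edge
  \<open>u v\<close> with \<open>u\<close> outside \<open>I\<close> would yield an induced cycle
  \<open>p u q v\<close>, by domination from \<open>p u\<close> and \<open>p v\<close>.\<close>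

lemma comp_clique_join_independent:
  "\<exists>I. \<forall>u\<in>C. \<forall>v\<in>C. u \<noteq> v \<longrightarrow> (E u v \<longleftrightarrow> \<not> (u \<in> I \<and> v \<in> I))"
proof (cases "\<exists>p\<in>C. \<exists>q\<in>C. p \<noteq> q \<and> \<not> E p q")
  case False
  then show ?thesis by (intro exI[of _ "{}"]) auto
next
  case True
  then obtain p q where pq: "p \<in> C" "q \<in> C" "p \<noteq> q" "\<not> E p q" by blast
  define I where "I = {z \<in> C. \<not> E p z}"
  have indep: "\<not> E u v" if "u \<in> I" "v \<in> I" for u v
    using comp_edge_dominates[of u v p] that pq(1) sym by (auto simp: I_def)
  have join: "E u v" if uv: "u \<in> C" "v \<in> C" "u \<noteq> v" "u \<notin> I" for u v
  proof (rule ccontr)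
    assume n: "\<not> E u v"
    have pu: "E p u" using uv by (simp add: I_def)
    then have pv: "E p v" using comp_edge_dominates[of p u v] pq uv n sym by blast
    have "E q u" "E q v"
      using comp_edge_dominates[of p u q] comp_edge_dominates[of p v q] pu pv pq uv sym by blast+
    then show False using no_C4[of p u q v] pu pv pq uv n sym by blast
  qed
  show ?thesis
    by (intro exI[of _ I] ballI impI) (use indep join sym in metis)
qed

end

lemma comp_eq:
  assumes "y \<in> R" "x \<in> R"
  shows "{z \<in> R. (x, z) \<in> conn E R} = {z \<in> R. (y, z) \<in> conn E R} \<longleftrightarrow> (x, y) \<in> conn E R"
proof
  assume eq: "{z \<in> R. (x, z) \<in> conn E R} = {z \<in> R. (y, z) \<in> conn E R}"
  have "x \<in> {z \<in> R. (x, z) \<in> conn E R}" using assms(2) by simp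
  then have "(y, x) \<in> conn E R" unfolding eq by simp
  then show "(x, y) \<in> conn E R" by (rule conn_sym)
next
  assume xy: "(x, y) \<in> conn E R"
  have "(x, z) \<in> conn E R \<longleftrightarrow> (y, z) \<in> conn E R" for z
    using xy by (metis conn_sym conn_trans)
  then show "{z \<in> R. (x, z) \<in> conn E R} = {z \<in> R. (y, z) \<in> conn E R}" by simp
qed

text \<open>Distinct components are anticomplete, so each is built separately and its labels are
  reset to 0. A component with a triangle is a clique joined to an independent set, any other is a
  tree.\<close>

lemma paw_free_nlc_width:
  assumes fin: "finite R" and pf: "paw_free R"
  shows "nlc_width_le E 2 R"
proof (cases "R = {}")
  case False
  define K where "K x = {z \<in> R. (x, z) \<in> conn E R}" for x
  obtain i :: "'a set \<Rightarrow> nat" where i: "inj_on i (K ` R)"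
    using finite_imp_inj_to_nat_seg[of "K ` R"] fin by blast
  have "nlc E 2 R (\<lambda>_. 0)"
  proof (rule nlc_blocks[OF fin False, where b = "i \<circ> K" and S = "\<lambda>_ _. False"])
    fix j assume "j \<in> (i \<circ> K) ` R"
    then obtain x where x: "x \<in> R" "j = i (K x)" by auto
    have "{v \<in> R. (i \<circ> K) v = j} = {v \<in> R. K v = K x}"
      using x i by (auto dest: inj_onD)
    also have "\<dots> = K x" using comp_eq[OF x(1)] conn_sym by (auto simp: K_def)
    finally have block: "{v \<in> R. (i \<circ> K) v = j} = K x" .
    have fin_x: "finite (K x)" and x_in: "x \<in> K x" using fin x by (auto simp: K_def)
    show "nlc E 2 {v \<in> R. (i \<circ> K) v = j} (\<lambda>_. 0)"
    proof (cases "\<exists>a\<in>K x. \<exists>b\<in>K x. \<exists>c\<in>K x. E a b \<and> E b c \<and> E a c")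
      case True
      then obtain a b c where abc: "a \<in> K x" "b \<in> K x" "c \<in> K x" "E a b" "E b c" "E a c" by blast
      have Ka: "K x = K a" using abc(1) comp_eq[of a R x] x by (auto simp: K_def)
      obtain I where I: "\<forall>u\<in>K a. \<forall>v\<in>K a. u \<noteq> v \<longrightarrow> (E u v \<longleftrightarrow> \<not> (u \<in> I \<and> v \<in> I))"
        using comp_clique_join_independent[OF pf, of a b c "K a"] abc by (auto simp: K_def)
      have "nlc E 2 (K x) (\<lambda>v. if v \<in> I then 0 else 1)"
        by (rule nlc_vertices[OF fin_x, where S = "\<lambda>i j. \<not> (i = 0 \<and> j = 0)"])
          (use I x_in Ka in auto)
      then show ?thesis unfolding block by (rule nlc_relabel[where s = "\<lambda>_. 0"]) auto
    next
      case False
      have "nlc E 2 (K x) (\<lambda>v. if v = x then 1 else 0)"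
        using False by (intro forest_nlc[OF fin_x x_in]) blast
      then show ?thesis unfolding block by (rule nlc_relabel[where s = "\<lambda>_. 0"]) auto
    qed
  next
    fix u v assume uv: "u \<in> R" "v \<in> R" "(i \<circ> K) u < (i \<circ> K) v"
    then have "(u, v) \<notin> conn E R" using comp_eq[of v R u] by (auto simp: K_def)
    then show "E u v \<longleftrightarrow> False" using conn_step[of u u E R v] uv by auto
  qed
  then show ?thesis by (rule nlc_width_leI)
qed (simp add: nlc_width_le_def)

end

section \<open>The neighbourhood of a simplicial vertex and the rest of the graph\<close>

text \<open>Here \<open>K\<close> is the neighbourhood of the simplicial vertex \<open>v0\<close>
  and \<open>R\<close> the set of the vertices that \<open>v0\<close> does not see. In
  \<open>no_copaw\<close> the isolated vertex is \<open>e\<close>, the pendant vertex is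
  \<open>x\<close> and the triangle is \<open>c y z\<close>.\<close>

locale simplicial_split = hole_free E for E :: "'a \<Rightarrow> 'a \<Rightarrow> bool" +
  fixes K R :: "'a set" and v0 :: 'a
  assumes finite_K: "finite K" and finite_R: "finite R" and disjoint: "K \<inter> R = {}"
    and clique: "\<lbrakk> k \<in> K; k' \<in> K; k \<noteq> k' \<rbrakk> \<Longrightarrow> E k k'"
    and v0_K: "k \<in> K \<Longrightarrow> E v0 k" and v0_R: "r \<in> R \<Longrightarrow> \<not> E v0 r"
    and no_copaw: "\<lbrakk> e \<in> insert v0 (K \<union> R); E c x; E c y; E c z; E y z; \<not> E x y; \<not> E x z;
      \<not> E e c; \<not> E e x; \<not> E e y; \<not> E e z \<rbrakk> \<Longrightarrow> False"
begin

definition missed :: "'a \<Rightarrow> 'a set" where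
  "missed k = {r \<in> R. \<not> E k r}"

lemma missed_subset: "missed k \<subseteq> R"
  by (auto simp: missed_def)

lemma paw_free_R: "paw_free R"
  unfolding paw_free_def
proof (intro ballI impI)
  fix c x y z assume *: "c \<in> R" "x \<in> R" "y \<in> R" "z \<in> R" "E c x" "E c y" "E c z" "E y z"
  then show "E x y \<or> E x z \<or> x = y \<or> x = z"
    using no_copaw[of v0 c x y z] v0_R by blast
qed

text \<open>With \<open>e\<close> as isolated vertex, \<open>k\<close> turns a vertex
  \<open>x\<close> plus an edge \<open>y z\<close> among its neighbours into a paw.\<close>

lemma no_P1_plus_P2:
  assumes "k \<in> K" "e \<in> missed k" "x \<in> R - missed k" "y \<in> R - missed k" "z \<in> R - missed k"
    and "E y z" "\<not> E x y" "\<not> E x z" "\<not> E e x" "\<not> E e y" "\<not> E e z"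
  shows False
  using no_copaw[of e k x y z] assms sym by (auto simp: missed_def)

text \<open>Otherwise the triangle \<open>j k v0\<close> with \<open>r\<close> pendant at
  \<open>j\<close>, together with the isolated vertex \<open>e\<close>, is forbidden.\<close>

lemma missed_join:
  assumes "j \<in> K" "k \<in> K" "e \<in> missed j" "e \<in> missed k" "r \<in> missed k" "r \<notin> missed j"
  shows "E e r"
proof (rule ccontr)
  assume n: "\<not> E e r"
  have a: "E j r" "\<not> E k r" "r \<in> R" "e \<in> R" "\<not> E j e" "\<not> E k e"
    using assms by (auto simp: missed_def)
  then have "E j k" using clique assms(1,2) by metis
  moreover have "E j v0" "E k v0" using v0_K assms(1,2) sym by blast+
  moreover have "\<not> E r v0" "\<not> E e v0" "\<not> E e j" "\<not> E e k" "\<not> E r k" using a v0_R sym by blast+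
  ultimately show False using no_copaw[of e j r k v0] n a by blast
qed

text \<open>An edge \<open>r s\<close> would close the induced 4-cycle
  \<open>j s r k\<close>.\<close>

lemma missed_anticomplete:
  assumes "j \<in> K" "k \<in> K" "r \<in> missed j - missed k" "s \<in> missed k - missed j"
  shows "\<not> E r s"
proof
  assume rs: "E r s"
  have a: "E j s" "E k r" "\<not> E j r" "\<not> E k s" "r \<in> R" "s \<in> R" using assms by (auto simp: missed_def)
  then have "E j k" using clique assms(1,2) by metis
  moreover have "j \<noteq> r" "s \<noteq> k" using assms(1,2) a disjoint by blast+
  ultimately show False using no_C4[of j s r k] a rs sym by blast
qed

text \<open>Two crossing sets would yield the induced 5-cycle \<open>j r e s k\<close>, with
  \<open>e\<close> in both sets and \<open>r\<close>, \<open>s\<close> in one each.\<close>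

lemma missed_laminar:
  assumes "j \<in> K" "k \<in> K"
  shows "missed j \<inter> missed k = {} \<or> missed j \<subseteq> missed k \<or> missed k \<subseteq> missed j"
proof (rule ccontr)
  assume "\<not> ?thesis"
  then obtain e r s where ers: "e \<in> missed j" "e \<in> missed k" "r \<in> missed k" "r \<notin> missed j"
    "s \<in> missed j" "s \<notin> missed k" by blast
  have "E e r" "E e s" "\<not> E s r"
    using missed_join[of j k e r] missed_join[of k j e s] missed_anticomplete[of j k s r] assms ers
    by auto
  moreover have a: "E j r" "E k s" "\<not> E j e" "\<not> E j s" "\<not> E k r" "\<not> E k e" "r \<in> R" "s \<in> R" "e \<in> R"
    using ers by (auto simp: missed_def)
  moreover have "E j k" using a clique assms by metis
  moreover have "j \<noteq> e" "j \<noteq> s" "r \<noteq> k" "e \<noteq> k" using assms a disjoint by blast+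
  moreover have "r \<noteq> s" using a by blast
  ultimately show False using no_C5[of j r e s k] sym by blast
qed

text \<open>By laminarity \<open>missed k\<close> would contain both disjoint sets, and
  \<open>missed_join\<close> would make them complete to each other although they are anticomplete.
  Hence intersecting families of these sets are chains.\<close>

lemma missed_not_meets_two:
  assumes "i \<in> K" "j \<in> K" "k \<in> K" "missed i \<inter> missed j = {}"
    and "missed k \<inter> missed i \<noteq> {}" "missed k \<inter> missed j \<noteq> {}"
  shows False
proof -
  have "missed i \<subseteq> missed k" "missed j \<subseteq> missed k"
    using missed_laminar[of k i] missed_laminar[of k j] assms by blast+
  moreover obtain e r where er: "e \<in> missed i" "r \<in> missed j" using assms by blast
  ultimately have "E e r" using missed_join[of i k e r] assms by blast
  moreover have "\<not> E e r" using missed_anticomplete[of i j e r] assms er by blast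
  ultimately show False by blast
qed

text \<open>An edge \<open>y z\<close> in \<open>missed j\<close> and a vertex \<open>x\<close> of
  \<open>missed k\<close> form a paw with \<open>i\<close>, and a vertex of \<open>missed i\<close>
  is isolated from it.\<close>

lemma missed_independent:
  assumes "i \<in> K" "j \<in> K" "k \<in> K" "missed i \<noteq> {}" "missed k \<noteq> {}"
    and "missed i \<inter> missed j = {}" "missed i \<inter> missed k = {}" "missed j \<inter> missed k = {}"
    and "y \<in> missed j" "z \<in> missed j"
  shows "\<not> E y z"
proof
  assume yz: "E y z"
  obtain e x where ex: "e \<in> missed i" "x \<in> missed k" using assms by blast
  have "\<not> E e x" "\<not> E e y" "\<not> E e z" "\<not> E x y" "\<not> E x z"
    using missed_anticomplete[of i k e x] missed_anticomplete[of i j e y]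
      missed_anticomplete[of i j e z] missed_anticomplete[of k j x y]
      missed_anticomplete[of k j x z] ex assms by blast+
  moreover have "x \<in> R - missed i" "y \<in> R - missed i" "z \<in> R - missed i"
    using ex assms missed_subset by blast+
  ultimately show False
    using no_P1_plus_P2[of i e x y z] ex assms(1) yz by blast
qed

subsection \<open>Four pairwise disjoint sets of missed vertices\<close>

context
  fixes k1 k2 k3 k4
  assumes k_in: "k1 \<in> K" "k2 \<in> K" "k3 \<in> K" "k4 \<in> K"
    and ne: "missed k1 \<noteq> {}" "missed k2 \<noteq> {}" "missed k3 \<noteq> {}" "missed k4 \<noteq> {}"
    and disj: "missed k1 \<inter> missed k2 = {}" "missed k1 \<inter> missed k3 = {}"
      "missed k1 \<inter> missed k4 = {}" "missed k2 \<inter> missed k3 = {}"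
      "missed k2 \<inter> missed k4 = {}" "missed k3 \<inter> missed k4 = {}"
begin

text \<open>The set \<open>missed k\<close> meets at most one of three pairwise disjoint ones; the
  two others serve as partners in \<open>missed_independent\<close>.\<close>

lemma missed_independent':
  assumes "k \<in> K" "y \<in> missed k" "z \<in> missed k"
  shows "\<not> E y z"
proof -
  have *: "missed k \<inter> missed i = {} \<or> missed k \<inter> missed j = {}"
    if "i \<in> K" "j \<in> K" "missed i \<inter> missed j = {}" for i j
    using missed_not_meets_two[OF that(1,2) assms(1) that(3)] by blast
  have **: "\<not> E y z" if "i \<in> K" "j \<in> K" "missed i \<inter> missed j = {}" "missed i \<noteq> {}" "missed j \<noteq> {}"
    "missed k \<inter> missed i = {}" "missed k \<inter> missed j = {}" for i j
    using missed_independent[of i k j y z] that assms by blast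
  show ?thesis
    using *[of k1 k2] *[of k1 k3] *[of k2 k3] **[of k1 k2] **[of k1 k3] **[of k2 k3] k_in ne disj
    by blast
qed

text \<open>A nonempty set strictly inside another would put an edge into the larger one by
  \<open>missed_join\<close>.\<close>

lemma missed_eq_or_disjoint:
  assumes "j \<in> K" "k \<in> K"
  shows "missed j = missed k \<or> missed j \<inter> missed k = {}"
proof -
  have *: "missed j = missed k" if jk: "j \<in> K" "k \<in> K" "missed j \<subseteq> missed k" "missed j \<noteq> {}" for j k
  proof (rule ccontr)
    assume "missed j \<noteq> missed k"
    then obtain e r where er: "e \<in> missed j" "r \<in> missed k" "r \<notin> missed j" using jk by blast
    then have "E e r" using missed_join[of j k e r] jk by blast
    then show False using missed_independent'[of k e r] er jk by blast
  qed
  show ?thesis using missed_laminar[OF assms] *[of j k] *[of k j] assms by blast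
qed

definition "all_missed = \<Union> (missed ` K)"

lemma all_missed_independent:
  assumes "y \<in> all_missed" "z \<in> all_missed"
  shows "\<not> E y z"
proof -
  obtain j k where jk: "j \<in> K" "k \<in> K" "y \<in> missed j" "z \<in> missed k"
    using assms by (auto simp: all_missed_def)
  show ?thesis
    using missed_eq_or_disjoint[OF jk(1,2)] missed_independent'[of k y z]
      missed_anticomplete[of j k y z] jk by blast
qed

text \<open>Otherwise \<open>k u z\<close> is a triangle with \<open>w\<close> pendant at
  \<open>k\<close>, and \<open>e\<close> is isolated from it.\<close>

lemma all_or_none_outside:
  assumes "k \<in> K" "e \<in> missed k" "z \<in> R - all_missed" "\<not> E z e"
    and "u \<in> all_missed - missed k" "w \<in> all_missed - missed k" "E z u"
  shows "E z w"
proof (rule ccontr)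
  assume "\<not> E z w"
  moreover have "all_missed \<subseteq> R" using missed_subset by (auto simp: all_missed_def)
  moreover have "e \<in> all_missed" "missed k \<subseteq> all_missed" using assms by (auto simp: all_missed_def)
  ultimately show False
    using no_P1_plus_P2[of k e w u z] assms all_missed_independent sym by blast
qed

text \<open>If the two sets were disjoint, the neighbour \<open>u\<close> would lie outside one of
  them, and \<open>all_or_none_outside\<close> for that set would make \<open>z\<close> see the
  missed vertex of the other.\<close>

lemma nonneighbours_in_one:
  assumes z: "z \<in> R - all_missed" "u \<in> all_missed" "E z u"
    and e: "j \<in> K" "k \<in> K" "e \<in> missed j" "f \<in> missed k" "\<not> E z e" "\<not> E z f"
  shows "missed j = missed k"
proof (rule ccontr)
  assume "missed j \<noteq> missed k"
  then have d: "missed j \<inter> missed k = {}" using missed_eq_or_disjoint e by blast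
  have "e \<in> all_missed" "f \<in> all_missed" using e by (auto simp: all_missed_def)
  then show False
    using all_or_none_outside[of j e z u f] all_or_none_outside[of k f z u e] z e d by blast
qed

text \<open>This is where four sets are used: of one representative from each, \<open>z\<close> and
  \<open>y\<close> miss at most one apiece, so at least two are common neighbours.\<close>

lemma common_neighbours:
  assumes "z \<in> R - all_missed" "u \<in> all_missed" "E z u"
    and "y \<in> R - all_missed" "w \<in> all_missed" "E y w"
  shows "\<exists>p\<in>all_missed. \<exists>q\<in>all_missed. p \<noteq> q \<and> E z p \<and> E z q \<and> E y p \<and> E y q"
proof -
  obtain w1 w2 w3 w4 where w: "w1 \<in> missed k1" "w2 \<in> missed k2" "w3 \<in> missed k3" "w4 \<in> missed k4"
    using ne by blast
  have *: "E x p \<or> E x q"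
    if "x \<in> R - all_missed" "u \<in> all_missed" "E x u" "i \<in> K" "j \<in> K"
      "p \<in> missed i" "q \<in> missed j" "missed i \<inter> missed j = {}" for x u p q i j
    using nonneighbours_in_one[of x u i j p q] that by blast
  note z = *[OF assms(1-3)] and y = *[OF assms(4-6)]
  have "w1 \<in> all_missed" "w2 \<in> all_missed" "w3 \<in> all_missed" "w4 \<in> all_missed"
    using w k_in by (auto simp: all_missed_def)
  moreover have "w1 \<noteq> w2" "w1 \<noteq> w3" "w1 \<noteq> w4" "w2 \<noteq> w3" "w2 \<noteq> w4" "w3 \<noteq> w4" using w disj by blast+
  moreover have "E z w1 \<or> E z w2" "E z w1 \<or> E z w3" "E z w1 \<or> E z w4" "E z w2 \<or> E z w3"
    "E z w2 \<or> E z w4" "E z w3 \<or> E z w4"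
    using z[OF k_in(1,2) w(1,2)] z[OF k_in(1,3) w(1,3)] z[OF k_in(1,4) w(1,4)]
      z[OF k_in(2,3) w(2,3)] z[OF k_in(2,4) w(2,4)] z[OF k_in(3,4) w(3,4)] disj by simp_all
  moreover have "E y w1 \<or> E y w2" "E y w1 \<or> E y w3" "E y w1 \<or> E y w4" "E y w2 \<or> E y w3"
    "E y w2 \<or> E y w4" "E y w3 \<or> E y w4"
    using y[OF k_in(1,2) w(1,2)] y[OF k_in(1,3) w(1,3)] y[OF k_in(1,4) w(1,4)]
      y[OF k_in(2,3) w(2,3)] y[OF k_in(2,4) w(2,4)] y[OF k_in(3,4) w(3,4)] disj by simp_all
  ultimately show ?thesis by metis
qed

text \<open>Two common neighbours \<open>p\<close>, \<open>q\<close> are non-adjacent, so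
  \<open>z\<close> and \<open>y\<close> are adjacent, or \<open>z p y q\<close> would be a hole.
  Then \<open>w\<close> cannot be pendant to the triangle \<open>y z p\<close>.\<close>

lemma same_neighbours:
  assumes "z \<in> R - all_missed" "u \<in> all_missed" "E z u"
    and "y \<in> R - all_missed" "w \<in> all_missed" "E y w"
  shows "E z w"
proof (cases "z = y")
  case False
  obtain p q where pq: "p \<in> all_missed" "q \<in> all_missed" "p \<noteq> q" "E z p" "E z q" "E y p" "E y q"
    using common_neighbours[OF assms] by blast
  have zy: "E z y"
    using no_C4[of z p y q] pq False all_missed_independent sym by blast
  have sub: "all_missed \<subseteq> R" using missed_subset by (auto simp: all_missed_def)
  have "E w z \<or> E w p \<or> w = z \<or> w = p"
    using paw_freeD[OF paw_free_R, of y w z p] assms pq zy sub sym by blast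
  then show ?thesis using assms pq all_missed_independent sym by blast
qed (use assms in simp)

lemma K_all_missed_nlc: "nlc E 2 (K \<union> all_missed) (\<lambda>v. if v \<in> K then 1 else 0)"
proof -
  \<comment> \<open>For \<open>v\<close> outside \<open>K\<close> the union picks the unique member
    of the family that contains \<open>v\<close>. A vertex of \<open>K\<close> sees one of
    \<open>all_missed\<close> exactly when their blocks differ.\<close>
  define P where "P v = (if v \<in> K then missed v else \<Union> {X \<in> missed ` K. v \<in> X})" for v
  let ?V = "K \<union> all_missed" and ?h = "\<lambda>v. if v \<in> K then 1 else 0 :: nat"
  have sub: "all_missed \<subseteq> R" using missed_subset by (auto simp: all_missed_def)
  have fin: "finite ?V" using finite_subset[OF sub finite_R] finite_K by simp
  have P: "P v = missed k" if "k \<in> K" "v \<in> missed k" for k v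
  proof -
    have "v \<notin> K" using that disjoint missed_subset by blast
    moreover have "{X \<in> missed ` K. v \<in> X} = {missed k}"
      using that missed_eq_or_disjoint by blast
    ultimately show ?thesis by (simp add: P_def)
  qed
  have adj: "E k w \<longleftrightarrow> P k \<noteq> P w" if kw: "k \<in> K" "w \<in> all_missed" for k w
  proof -
    obtain j where j: "j \<in> K" "w \<in> missed j" using kw by (auto simp: all_missed_def)
    have "E k w \<longleftrightarrow> w \<notin> missed k" using j by (auto simp: missed_def)
    also have "\<dots> \<longleftrightarrow> missed k \<noteq> missed j" using missed_eq_or_disjoint[OF kw(1) j(1)] j by blast
    finally show ?thesis using P[OF j] kw(1) by (simp add: P_def)
  qed
  obtain i :: "'a set \<Rightarrow> nat" where i: "inj_on i (P ` ?V)"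
    using finite_imp_inj_to_nat_seg[of "P ` ?V"] fin by blast
  have iP: "i (P u) = i (P v) \<longleftrightarrow> P u = P v" if "u \<in> ?V" "v \<in> ?V" for u v
    by (rule inj_on_eq_iff[OF i]) (use that in blast)+
  show ?thesis
  proof (rule nlc_blocks[OF fin, where b = "i \<circ> P" and S = "\<lambda>i j. \<not> (i = 0 \<and> j = 0)"])
    show "?V \<noteq> {}" using k_in by blast
    fix n assume "n \<in> (i \<circ> P) ` ?V"
    then obtain x where x: "x \<in> ?V" "n = i (P x)" by auto
    then have block: "{v \<in> ?V. (i \<circ> P) v = n} = {v \<in> ?V. P v = P x}" using iP by auto
    show "nlc E 2 {v \<in> ?V. (i \<circ> P) v = n} ?h"
      unfolding block
    proof (rule nlc_vertices[where S = "\<lambda>i j. i = 1 \<and> j = 1"])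
      fix u v assume uv: "u \<in> {v \<in> ?V. P v = P x}" "v \<in> {v \<in> ?V. P v = P x}" "u \<noteq> v"
      show "E u v \<longleftrightarrow> ?h u = 1 \<and> ?h v = 1"
        using uv adj[of u v] adj[of v u] clique[of u v] all_missed_independent[of u v] sym
        by (cases "u \<in> K"; cases "v \<in> K") auto
    qed (use fin x in auto)
  next
    fix u v assume uv: "u \<in> ?V" "v \<in> ?V" "(i \<circ> P) u < (i \<circ> P) v"
    then have "P u \<noteq> P v" "u \<noteq> v" by auto
    then show "E u v \<longleftrightarrow> \<not> (?h u = 0 \<and> ?h v = 0)"
      using uv adj[of u v] adj[of v u] clique[of u v] all_missed_independent[of u v] sym
      by (cases "u \<in> K"; cases "v \<in> K") auto
  qed
qed

lemma width_four_disjoint: "nlc_width_le E 8 (K \<union> R)"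
proof -
  define Z where "Z = R - all_missed"
  \<comment> \<open>\<open>N\<close> collects the vertices of \<open>all_missed\<close> and
    \<open>Z\<close> with a neighbour on the other side; by \<open>same_neighbours\<close> these are
    joined completely.\<close>
  define N where "N = {v. v \<notin> K \<and> (\<exists>u\<in>all_missed. \<exists>z\<in>Z. E z u \<and> (v = u \<or> v = z))}"
  have sub: "all_missed \<subseteq> R" using missed_subset by (auto simp: all_missed_def)
  have "nlc_width_le E (2 * 4) ((K \<union> all_missed) \<union> Z)"
  proof (rule nlc_width_le_union[where C = UNIV and c = "\<lambda>v. (v \<in> K, v \<in> N)"
        and S = "\<lambda>p q. fst p \<or> snd p \<and> snd q"])
    show "nlc_width_le E 2 (K \<union> all_missed)" by (rule nlc_width_leI[OF K_all_missed_nlc])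
    show "nlc_width_le E 2 Z"
      using finite_R paw_free_R by (intro paw_free_nlc_width) (auto simp: Z_def intro: paw_free_subset)
    show "card (UNIV :: (bool \<times> bool) set) \<le> 4" by (simp add: card_UNIV_bool flip: UNIV_Times_UNIV)
    show "(K \<union> all_missed) \<inter> Z = {}" using disjoint by (auto simp: Z_def)
    fix u z assume u: "u \<in> K \<union> all_missed" and z: "z \<in> Z"
    show "E u z \<longleftrightarrow> fst (u \<in> K, u \<in> N) \<or> snd (u \<in> K, u \<in> N) \<and> snd (z \<in> K, z \<in> N)"
    proof (cases "u \<in> K")
      case True
      then have "z \<notin> missed u" "z \<in> R" using z by (auto simp: Z_def all_missed_def)
      then show ?thesis using True by (auto simp: missed_def)
    next
      case False
      with u have u: "u \<in> all_missed" by simp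
      have "z \<notin> K" using z disjoint by (auto simp: Z_def)
      have "E u z" if N: "u \<in> N" "z \<in> N"
      proof -
        obtain z' where "z' \<in> Z" "E z' u" using N u by (auto simp: N_def Z_def)
        moreover obtain u' where "u' \<in> all_missed" "E z u'" using N z by (auto simp: N_def Z_def)
        ultimately have "E z u" using same_neighbours[of z u' z' u] z u by (auto simp: Z_def)
        then show ?thesis by (rule sym)
      qed
      moreover have "u \<in> N \<and> z \<in> N" if "E u z"
        using sym[OF that] False u z \<open>z \<notin> K\<close> by (auto simp: N_def)
      ultimately show ?thesis using False by auto
    qed
  qed auto
  moreover have "(K \<union> all_missed) \<union> Z = K \<union> R" using sub by (auto simp: Z_def)
  ultimately show ?thesis by simp
qed

end

end

text \<open>The minimal members are pairwise disjoint, so there are at most three. Without chains of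
  three, mapping each other member to a minimal one below it is injective, which gives at most three
  more.\<close>

lemma card_no_chain_no_antichain:
  fixes F :: "'b set set"
  assumes fin: "finite F" and ne: "{} \<notin> F"
    and lam: "\<And>X Y. \<lbrakk> X \<in> F; Y \<in> F \<rbrakk> \<Longrightarrow> X \<inter> Y = {} \<or> X \<subseteq> Y \<or> Y \<subseteq> X"
    and chain: "\<And>X Y Z. \<lbrakk> X \<in> F; Y \<in> F; Z \<in> F; X \<subset> Y; Y \<subset> Z \<rbrakk> \<Longrightarrow> False"
    and anti: "\<And>A. \<lbrakk> A \<subseteq> F; pairwise disjnt A \<rbrakk> \<Longrightarrow> card A \<le> 3"
  shows "card F \<le> 6"
proof -
  define A where "A = {X \<in> F. \<forall>Y\<in>F. \<not> Y \<subset> X}"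
  have A: "finite A" "A \<subseteq> F" using fin by (auto simp: A_def)
  have "pairwise disjnt A"
  proof (rule pairwiseI)
    fix X Y assume "X \<in> A" "Y \<in> A" "X \<noteq> Y"
    then show "disjnt X Y" using lam[of X Y] by (auto simp: A_def disjnt_def)
  qed
  then have "card A \<le> 3" using anti A by blast
  have "\<forall>X\<in>F - A. \<exists>Y. Y \<in> A \<and> Y \<subset> X"
  proof
    fix X assume X: "X \<in> F - A"
    then obtain Y where Y: "Y \<in> F" "Y \<subset> X" by (auto simp: A_def)
    with X chain have "Y \<in> A" by (auto simp: A_def)
    with Y show "\<exists>Y. Y \<in> A \<and> Y \<subset> X" by blast
  qed
  then obtain g where g: "\<And>X. X \<in> F - A \<Longrightarrow> g X \<in> A \<and> g X \<subset> X" by metis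
  have "inj_on g (F - A)"
  proof (rule inj_onI)
    fix X Y assume XY: "X \<in> F - A" "Y \<in> F - A" "g X = g Y"
    have "g X \<noteq> {}" "g X \<in> F" using g[OF XY(1)] A(2) ne by auto
    then have "X \<inter> Y \<noteq> {}" using g[OF XY(1)] g[OF XY(2)] XY(3) by auto
    then have "X \<subseteq> Y \<or> Y \<subseteq> X" using lam XY by blast
    then show "X = Y"
      using chain[of "g X" X Y] chain[of "g X" Y X] g[OF XY(1)] g[OF XY(2)] XY \<open>g X \<in> F\<close> by auto
  qed
  then have "card (F - A) \<le> card A"
    using g A by (intro card_inj_on_le[where f = g]) auto
  moreover have "card F = card A + card (F - A)"
    using A fin by (simp add: card_Diff_subset card_mono)
  ultimately show ?thesis using \<open>card A \<le> 3\<close> by simp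
qed

context simplicial_split
begin

section \<open>Components of \<open>R\<close> and the vertices of \<open>K\<close> that miss part of
  them\<close>

definition comp :: "'a \<Rightarrow> 'a set" where
  "comp x = {z \<in> R. (x, z) \<in> conn E R}"

lemma comp_eq_iff: "\<lbrakk> x \<in> R; y \<in> R \<rbrakk> \<Longrightarrow> comp x = comp y \<longleftrightarrow> (x, y) \<in> conn E R"
  unfolding comp_def by (rule comp_eq)

lemma in_comp: "x \<in> R \<Longrightarrow> x \<in> comp x"
  by (simp add: comp_def)

lemma comp_eqI: "\<lbrakk> x \<in> R; y \<in> comp x \<rbrakk> \<Longrightarrow> comp y = comp x"
  using comp_eq_iff[of x y] by (auto simp: comp_def)

lemma comp_closed: "\<lbrakk> y \<in> comp x; z \<in> R; E y z \<rbrakk> \<Longrightarrow> z \<in> comp x"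
  using conn_step[of x y E R z] by (auto simp: comp_def)

subsection \<open>Components containing a large set of missed vertices\<close>

definition "meeting C = {k \<in> K. missed k \<inter> C \<noteq> {}}"

context
  fixes C k0 a b c
  assumes k0: "k0 \<in> K" and abc: "a \<in> missed k0" "b \<in> missed k0" "c \<in> missed k0"
    and tri: "E a b" "E b c" "E a c"
    and C: "C = comp a" and sub: "missed k0 \<subseteq> C"
begin

lemma abc_R: "a \<in> R" "b \<in> R" "c \<in> R"
  using abc missed_subset by blast+

text \<open>The edge \<open>a b\<close> dominates \<open>C\<close>, so a set that meets
  \<open>C\<close> but is disjoint from \<open>missed k0\<close> would contradict anticompleteness.
  Vertices it has beyond \<open>missed k0\<close> are adjacent to \<open>a\<close>, hence in
  \<open>C\<close>.\<close>

lemma meeting_comparable: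
  assumes "k \<in> meeting C"
  shows "missed k \<subseteq> C \<and> (missed k \<subseteq> missed k0 \<or> missed k0 \<subseteq> missed k)"
proof -
  obtain x where x: "k \<in> K" "x \<in> missed k" "x \<in> C" using assms by (auto simp: meeting_def)
  have "missed k \<inter> missed k0 \<noteq> {}"
  proof
    assume d: "missed k \<inter> missed k0 = {}"
    have "a \<in> C" "b \<in> C" using abc sub by blast+
    then have "x = a \<or> x = b \<or> E x a \<or> E x b"
      using comp_edge_dominates[OF paw_free_R abc_R tri(1,3,2) _ _ _ tri(1) x(3)] C
      by (auto simp: comp_def)
    then show False
      using missed_anticomplete[of k k0 x] x k0 abc d by blast
  qed
  then have cmp: "missed k \<subseteq> missed k0 \<or> missed k0 \<subseteq> missed k"
    using missed_laminar[OF x(1) k0] by blast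
  have "y \<in> C" if y: "y \<in> missed k" "y \<notin> missed k0" for y
  proof -
    have "E a y" using missed_join[of k0 k a y] cmp abc y x k0 by blast
    then show ?thesis using comp_closed[of a a y] C in_comp[OF abc_R(1)] y missed_subset by blast
  qed
  then show ?thesis using cmp sub by blast
qed

lemma meeting_chain:
  assumes "j \<in> meeting C" "k \<in> meeting C"
  shows "missed j \<subseteq> missed k \<or> missed k \<subseteq> missed j"
proof (rule ccontr)
  assume n: "\<not> ?thesis"
  have jk: "j \<in> K" "k \<in> K" "missed j \<noteq> {}" "missed k \<noteq> {}" using assms by (auto simp: meeting_def)
  then have d: "missed j \<inter> missed k = {}" using n missed_laminar by blast
  then have s: "missed j \<inter> missed k0 \<noteq> {}" "missed k \<inter> missed k0 \<noteq> {}"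
    using meeting_comparable[OF assms(1)] meeting_comparable[OF assms(2)] jk abc by blast+
  then show False using missed_not_meets_two[of j k k0] jk k0 d by blast
qed

lemma component_nlc: "nlc E 3 (meeting C \<union> C) (\<lambda>v. if v \<in> K then 1 else 0)"
proof -
  let ?V = "meeting C \<union> C"
  have CR: "C \<subseteq> R" and aC: "a \<in> C" using C in_comp[OF abc_R(1)] by (auto simp: comp_def)
  have fin: "finite ?V" using finite_subset[OF CR finite_R] finite_K by (auto simp: meeting_def)
  have mK: "meeting C \<subseteq> K" by (auto simp: meeting_def)
  have finM: "finite (meeting C)" using finite_subset[OF mK finite_K] .
  obtain I where I: "\<forall>u\<in>C. \<forall>v\<in>C. u \<noteq> v \<longrightarrow> (E u v \<longleftrightarrow> \<not> (u \<in> I \<and> v \<in> I))"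
    using comp_clique_join_independent[OF paw_free_R abc_R tri(1,3,2)] C by (auto simp: comp_def)
  define l where "l v = (if v \<in> K then 2 else if v \<in> I then 0 else 1 :: nat)" for v
  \<comment> \<open>The position in the sweep: on the chain of missed sets, a vertex of
    \<open>C\<close> comes after exactly those \<open>k\<close> that see it.\<close>
  define b where "b v = card (if v \<in> K then {k \<in> meeting C. missed k \<subset> missed v}
    else {k \<in> meeting C. v \<notin> missed k})" for v
  have key: "E k x \<longleftrightarrow> b k < b x" if k: "k \<in> meeting C" and x: "x \<in> C" for k x
  proof -
    have kK: "k \<in> K" "x \<notin> K" "x \<in> R" using k x mK CR disjoint by auto
    show ?thesis
    proof (cases "x \<in> missed k")
      case True
      have "{j \<in> meeting C. x \<notin> missed j} \<subseteq> {j \<in> meeting C. missed j \<subset> missed k}"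
        using meeting_chain[OF _ k] True by blast
      then have "b x \<le> b k" using kK finM by (auto simp: b_def intro: card_mono)
      then show ?thesis using True by (auto simp: missed_def)
    next
      case False
      have "{j \<in> meeting C. missed j \<subset> missed k} \<subset> {j \<in> meeting C. x \<notin> missed j}"
        using False k by blast
      then have "b k < b x" using kK finM psubset_card_mono[of "{j \<in> meeting C. x \<notin> missed j}"] by (simp add: b_def)
      then show ?thesis using False kK by (auto simp: missed_def)
    qed
  qed
  have K: "v \<in> K \<longleftrightarrow> v \<in> meeting C" "v \<notin> K \<longleftrightarrow> v \<in> C" if "v \<in> ?V" for v
    using that mK CR disjoint by auto
  have KK: "E u v" if "u \<in> K" "v \<in> K" "u \<noteq> v" for u v using clique that by blast
  have CC: "E u v \<longleftrightarrow> \<not> (u \<in> I \<and> v \<in> I)" if "u \<in> C" "v \<in> C" "u \<noteq> v" for u v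
    using I that by blast
  \<comment> \<open>Label 2 is \<open>meeting C\<close>, label 0 is \<open>I\<close>, label 1 the
    rest of \<open>C\<close>. A vertex of label 2 sees everything placed later, whereas one of
    \<open>C\<close> sees no later vertex of label 2.\<close>
  have "nlc E 3 ?V l"
  proof (rule nlc_blocks[OF fin, where b = b
        and S = "\<lambda>i j. i = 2 \<or> j \<noteq> 2 \<and> \<not> (i = 0 \<and> j = 0)"])
    show "?V \<noteq> {}" using aC by blast
  next
    fix n assume n: "n \<in> b ` ?V"
    show "nlc E 3 {v \<in> ?V. b v = n} l"
    proof (rule nlc_vertices[where S = "\<lambda>i j. (i = 2 \<longleftrightarrow> j = 2) \<and> \<not> (i = 0 \<and> j = 0)"])
      fix u v assume uv: "u \<in> {v \<in> ?V. b v = n}" "v \<in> {v \<in> ?V. b v = n}" "u \<noteq> v"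
      show "E u v \<longleftrightarrow> (l u = 2 \<longleftrightarrow> l v = 2) \<and> \<not> (l u = 0 \<and> l v = 0)"
        using uv K[of u] K[of v] KK[of u v] CC[of u v] key[of u v] key[of v u] sym[of u v]
        by (cases "u \<in> K"; cases "v \<in> K") (auto simp: l_def)
    qed (use fin n in \<open>auto simp: l_def\<close>)
  next
    fix u v assume uv: "u \<in> ?V" "v \<in> ?V" "b u < b v"
    then have "u \<noteq> v" by auto
    then show "E u v \<longleftrightarrow> l u = 2 \<or> l v \<noteq> 2 \<and> \<not> (l u = 0 \<and> l v = 0)"
      using uv K[of u] K[of v] KK[of u v] CC[of u v] key[of u v] key[of v u] sym[of u v]
      by (cases "u \<in> K"; cases "v \<in> K") (auto simp: l_def)
  qed
  then show ?thesis
    by (rule nlc_relabel[where s = "\<lambda>i. if i = 2 then 1 else 0"]) (auto simp: l_def)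
qed

end

definition special :: "'a set \<Rightarrow> bool" where
  "special C \<longleftrightarrow> (\<exists>k\<in>K. \<exists>a\<in>missed k. \<exists>b\<in>missed k. \<exists>c\<in>missed k.
     E a b \<and> E b c \<and> E a c \<and> C = comp a \<and> missed k \<subseteq> C)"

lemma special_missed_subset: "\<lbrakk> special C; k \<in> meeting C \<rbrakk> \<Longrightarrow> missed k \<subseteq> C"
  unfolding special_def using meeting_comparable by metis

lemma special_nlc: "special C \<Longrightarrow> nlc E 3 (meeting C \<union> C) (\<lambda>v. if v \<in> K then 1 else 0)"
  unfolding special_def using component_nlc by metis

lemma special_comp: "special C \<Longrightarrow> \<exists>x\<in>R. C = comp x"
  unfolding special_def using missed_subset by blast

lemma special_comp_eq: "\<lbrakk> special C; x \<in> C \<rbrakk> \<Longrightarrow> comp x = C"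
  using special_comp comp_eqI by metis

text \<open>Vertices \<open>x\<close>, \<open>y\<close>, \<open>z\<close> from the successive layers
  form a triangle by \<open>missed_join\<close>. The members of \<open>missed k3\<close> outside
  \<open>missed k1\<close> are adjacent to \<open>x\<close>, those inside to \<open>z\<close>, so
  all lie in one component.\<close>

lemma chain_special:
  assumes k: "k1 \<in> K" "k2 \<in> K" "k3 \<in> K" "missed k1 \<noteq> {}"
    and ch: "missed k1 \<subset> missed k2" "missed k2 \<subset> missed k3"
  shows "\<exists>C. special C \<and> k3 \<in> meeting C"
proof -
  obtain x y z where xyz: "x \<in> missed k1" "y \<in> missed k2" "y \<notin> missed k1"
    "z \<in> missed k3" "z \<notin> missed k2" using k(4) ch by blast
  have m3: "x \<in> missed k3" "y \<in> missed k3" using xyz ch by auto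
  have e: "E x y" "E y z" "E x z"
    using missed_join[of k1 k2 x y] missed_join[of k2 k3 y z] missed_join[of k1 k3 x z] k ch xyz m3
    by blast+
  have R: "x \<in> R" "z \<in> R" using m3 xyz missed_subset by blast+
  have zC: "z \<in> comp x" using comp_closed[OF in_comp[OF R(1)] R(2) e(3)] .
  have "w \<in> comp x" if w: "w \<in> missed k3" for w
  proof (cases "w \<in> missed k1")
    case False
    then have "E x w" using missed_join[of k1 k3 x w] k xyz m3 w by blast
    then show ?thesis using comp_closed[OF in_comp[OF R(1)]] w missed_subset by blast
  next
    case True
    then have "E w z" using missed_join[of k2 k3 w z] k ch xyz w by blast
    then show ?thesis using comp_closed[OF zC] w missed_subset sym by blast
  qed
  then have "special (comp x)" unfolding special_def using k(3) m3 xyz(4) e by blast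
  moreover have "k3 \<in> meeting (comp x)" using k(3) m3(1) in_comp[OF R(1)] by (auto simp: meeting_def)
  ultimately show ?thesis by blast
qed

subsection \<open>At most three pairwise disjoint sets of missed vertices\<close>

lemma width_few_missed:
  assumes sub: "K' \<subseteq> K" "R' \<subseteq> R" and few: "card (missed ` K') \<le> 7"
  shows "nlc_width_le E 270 (K' \<union> R')"
proof -
  have fin: "finite K'" "finite R'" using sub finite_subset finite_K finite_R by blast+
  let ?F = "missed ` K'"
  \<comment> \<open>A vertex of \<open>K\<close> is marked by its missed set and a vertex of
    \<open>R\<close> by the sets containing it, which makes at most \<open>7 + 2 ^ 7 = 135\<close>
    marks.\<close>
  let ?c = "\<lambda>v. if v \<in> K then Inl (missed v) else Inr {X \<in> ?F. v \<in> X}"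
  let ?C = "Inl ` ?F \<union> Inr ` Pow ?F :: ('a set + 'a set set) set"
  have "nlc_width_le E (2 * 135) (K' \<union> R')"
  proof (rule nlc_width_le_union[where c = ?c and C = ?C and S = "\<lambda>p q. projl p \<notin> projr q"])
    show "nlc_width_le E 2 K'"
    proof (cases "K' = {}")
      case False
      have "nlc E 2 K' (\<lambda>_. 0)"
        by (rule nlc_vertices[OF fin(1) False, where S = "\<lambda>_ _. True"]) (use clique sub in auto)
      then show ?thesis by (rule nlc_width_leI)
    qed (simp add: nlc_width_le_def)
    show "nlc_width_le E 2 R'"
      using fin(2) paw_free_subset[OF paw_free_R sub(2)] by (rule paw_free_nlc_width)
    show "finite ?C" using fin by simp
    have "card ?C \<le> card ?F + card (Pow ?F)"
      by (rule order_trans[OF card_Un_le]) (use fin in \<open>auto intro!: add_mono card_image_le\<close>)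
    also have "\<dots> = card ?F + 2 ^ card ?F" using fin by (simp add: card_Pow)
    also have "\<dots> \<le> 7 + 2 ^ 7" using few by (intro add_mono power_increasing) auto
    finally show "card ?C \<le> 135" by simp
    fix u w assume uw: "u \<in> K'" "w \<in> R'"
    then have "u \<in> K" "w \<in> R" "w \<notin> K" using sub disjoint by auto
    then show "E u w \<longleftrightarrow> projl (?c u) \<notin> projr (?c w)"
      using uw by (auto simp: missed_def)
  next
    show "?c ` (K' \<union> R') \<subseteq> ?C"
    proof (rule image_subsetI)
      fix v assume v: "v \<in> K' \<union> R'"
      show "?c v \<in> ?C"
      proof (cases "v \<in> K")
        case True
        then have "v \<in> K'" using v sub disjoint by blast
        then show ?thesis using True by simp
      next
        case False
        have "{X \<in> ?F. v \<in> X} \<in> Pow ?F" by blast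
        then show ?thesis using False by simp
      qed
    qed
    show "K' \<inter> R' = {}" using sub disjoint by blast
  qed simp
  then show ?thesis by simp
qed

lemma width_few_disjoint:
  assumes few: "\<And>F. \<lbrakk> F \<subseteq> missed ` K; {} \<notin> F; pairwise disjnt F \<rbrakk> \<Longrightarrow> card F \<le> 3"
  shows "nlc_width_le E 540 (K \<union> R)"
proof (cases "K \<union> R = {}")
  case False
  let ?h = "\<lambda>v. if v \<in> K then 1 else 0 :: nat"
  \<comment> \<open>The special component that a vertex belongs to or misses part of; the union
    selects the only candidate and is \<open>{}\<close> if there is none. Vertices with value
    \<open>{}\<close> form the remaining block.\<close>
  define P where "P v = (if v \<in> K then \<Union> {C. special C \<and> v \<in> meeting C}
    else if special (comp v) then comp v else {})" for v
  have P_meeting: "P k = C" if k: "special C" "k \<in> meeting C" for C k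
  proof -
    have kK: "k \<in> K" and ne: "missed k \<noteq> {}" using k by (auto simp: meeting_def)
    have uniq: "C' = C" if C': "special C'" "k \<in> meeting C'" for C'
    proof -
      obtain x where x: "x \<in> missed k" using ne by blast
      then have "x \<in> C" "x \<in> C'" using special_missed_subset k C' by blast+
      then show ?thesis using special_comp_eq k C' by metis
    qed
    have "{C. special C \<and> k \<in> meeting C} = {C}" using k uniq by blast
    then show ?thesis using kK by (simp add: P_def)
  qed
  have P_R: "P x = (if special (comp x) then comp x else {})" if "x \<in> R" for x
    using that disjoint by (auto simp: P_def)
  have P_special: "special (P v)" if Pv: "v \<in> K \<union> R" "P v \<noteq> {}" for v
  proof (cases "v \<in> K")
    case True
    then obtain C where "special C" "v \<in> meeting C" using Pv(2) by (auto simp: P_def)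
    then show ?thesis using P_meeting by simp
  qed (use Pv in \<open>auto simp: P_def split: if_splits\<close>)
  have P_iff: "P v = C \<longleftrightarrow> v \<in> meeting C \<union> C" if C: "special C" and v: "v \<in> K \<union> R" for C v
  proof -
    obtain x where x: "x \<in> R" "C = comp x" using special_comp C by blast
    have ne: "C \<noteq> {}" using x in_comp by blast
    show ?thesis
    proof (cases "v \<in> K")
      case True
      have "P v = C \<longleftrightarrow> v \<in> meeting C"
      proof
        assume PC: "P v = C"
        then obtain C' where "special C'" "v \<in> meeting C'" using True ne by (auto simp: P_def)
        then show "v \<in> meeting C" using P_meeting PC by metis
      qed (use P_meeting C in blast)
      moreover have "v \<notin> C" using True x disjoint by (auto simp: comp_def)
      ultimately show ?thesis by blast
    next
      case False
      then have "v \<in> R" "v \<notin> meeting C" using v by (auto simp: meeting_def)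
      then show ?thesis using P_R special_comp_eq[OF C] in_comp[of v] C ne by auto
    qed
  qed
  have adj_KR: "E k x" if k: "k \<in> K" and x: "x \<in> R" and neq: "P k \<noteq> P x" for k x
  proof (rule ccontr)
    assume "\<not> E k x"
    then have xm: "x \<in> missed k" using x by (simp add: missed_def)
    show False
    proof (cases "special (comp x)")
      case True
      then have "k \<in> meeting (comp x)" using xm in_comp[OF x] k by (auto simp: meeting_def)
      then show False using P_meeting[OF True] P_R[OF x] True neq by simp
    next
      case F: False
      then have "P k \<noteq> {}" using neq P_R[OF x] by simp
      then obtain C where C: "special C" "k \<in> meeting C" using k by (auto simp: P_def)
      then have "x \<in> C" using special_missed_subset xm by blast
      then show False using special_comp_eq[OF C(1)] C F by metis
    qed
  qed
  have adj_RR: "\<not> E x y" if "x \<in> R" "y \<in> R" "P x \<noteq> P y" for x y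
  proof
    assume "E x y"
    then have "comp y = comp x"
      using comp_eqI[OF that(1)] comp_closed[OF in_comp[OF that(1)] that(2)] by blast
    then have "P y = P x" unfolding P_R[OF that(1)] P_R[OF that(2)] by (rule arg_cong)
    then show False using that(3) by simp
  qed
  have rest: "nlc E 540 {v \<in> K \<union> R. P v = {}} ?h" if ne: "{v \<in> K \<union> R. P v = {}} \<noteq> {}"
  proof -
    define K' where "K' = {k \<in> K. P k = {}}"
    have no_special: "\<not> (special C \<and> k \<in> meeting C)" if "k \<in> K'" for k C
    proof
      assume C: "special C \<and> k \<in> meeting C"
      then have "C = {}" using that P_meeting by (auto simp: K'_def)
      then show False using C by (auto simp: meeting_def)
    qed
    \<comment> \<open>A chain of three would put a vertex of \<open>K'\<close> into
      \<open>meeting C\<close> for a special \<open>C\<close>. The bound 7 below allows for the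
      empty set.\<close>
    have "card (missed ` K' - {{}}) \<le> 6"
    proof (rule card_no_chain_no_antichain)
      show "finite (missed ` K' - {{}})" using finite_K by (auto simp: K'_def)
      fix X Y assume "X \<in> missed ` K' - {{}}" "Y \<in> missed ` K' - {{}}"
      then show "X \<inter> Y = {} \<or> X \<subseteq> Y \<or> Y \<subseteq> X" using missed_laminar by (auto simp: K'_def)
    next
      fix X Y Z assume *: "X \<in> missed ` K' - {{}}" "Y \<in> missed ` K' - {{}}"
        "Z \<in> missed ` K' - {{}}" "X \<subset> Y" "Y \<subset> Z"
      then obtain k1 k2 k3 where "k1 \<in> K'" "k2 \<in> K'" "k3 \<in> K'"
        "X = missed k1" "Y = missed k2" "Z = missed k3" by blast
      then show False using chain_special[of k1 k2 k3] no_special[of k3] * by (auto simp: K'_def)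
    next
      fix A assume "A \<subseteq> missed ` K' - {{}}" "pairwise disjnt A"
      then show "card A \<le> 3" by (intro few) (auto simp: K'_def)
    qed auto
    then have "card (missed ` K') \<le> 7"
      by (cases "{} \<in> missed ` K'") (auto simp: card_Diff_singleton)
    then have "nlc_width_le E 270 (K' \<union> {x \<in> R. P x = {}})"
      by (intro width_few_missed) (auto simp: K'_def)
    moreover have "K' \<union> {x \<in> R. P x = {}} = {v \<in> K \<union> R. P v = {}}" by (auto simp: K'_def)
    ultimately have "nlc E (270 * 2) {v \<in> K \<union> R. P v = {}} ?h"
      using ne by (intro nlc_with_marks) auto
    then show ?thesis by simp
  qed
  have fin: "finite (K \<union> R)" using finite_K finite_R by simp
  obtain i :: "'a set \<Rightarrow> nat" where i: "inj_on i (P ` (K \<union> R))"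
    using finite_imp_inj_to_nat_seg[of "P ` (K \<union> R)"] fin by blast
  have iP: "i (P u) = i (P v) \<longleftrightarrow> P u = P v" if "u \<in> K \<union> R" "v \<in> K \<union> R" for u v
    by (rule inj_on_eq_iff[OF i]) (use that in blast)+
  have "nlc E 540 (K \<union> R) ?h"
  proof (rule nlc_blocks[OF fin False, where b = "i \<circ> P" and S = "\<lambda>i j. \<not> (i = 0 \<and> j = 0)"])
    fix n assume "n \<in> (i \<circ> P) ` (K \<union> R)"
    then obtain x where x: "x \<in> K \<union> R" "n = i (P x)" by auto
    then have block: "{v \<in> K \<union> R. (i \<circ> P) v = n} = {v \<in> K \<union> R. P v = P x}" using iP by auto
    show "nlc E 540 {v \<in> K \<union> R. (i \<circ> P) v = n} ?h"
    proof (cases "P x = {}")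
      case True
      then show ?thesis unfolding block using rest x(1) by auto
    next
      case F: False
      then have sp: "special (P x)" using P_special x by blast
      have "P x \<subseteq> R" using special_comp[OF sp] by (auto simp: comp_def)
      then have "{v \<in> K \<union> R. P v = P x} = meeting (P x) \<union> P x"
        using P_iff[OF sp] by (auto simp: meeting_def)
      then show ?thesis unfolding block using nlc_mono[OF special_nlc[OF sp], of 540] by simp
    qed
  next
    fix u v assume uv: "u \<in> K \<union> R" "v \<in> K \<union> R" "(i \<circ> P) u < (i \<circ> P) v"
    then have "P u \<noteq> P v" "u \<noteq> v" by auto
    then show "E u v \<longleftrightarrow> \<not> (?h u = 0 \<and> ?h v = 0)"
      using uv adj_KR[of u v] adj_KR[of v u] adj_RR[of u v] clique[of u v] sym[of v u] disjoint
      by (cases "u \<in> K"; cases "v \<in> K") auto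
  qed
  then show ?thesis by (rule nlc_width_leI)
qed (simp add: nlc_width_le_def)

lemma width_le: "nlc_width_le E 540 (K \<union> R)"
proof (cases "\<exists>F. F \<subseteq> missed ` K \<and> {} \<notin> F \<and> pairwise disjnt F \<and> card F > 3")
  case False
  then show ?thesis by (intro width_few_disjoint) (meson not_le)
next
  case True
  then obtain F where F: "F \<subseteq> missed ` K" "{} \<notin> F" "pairwise disjnt F" "card F \<ge> 4" by auto
  then obtain F' where F': "F' \<subseteq> F" "card F' = 4" by (meson obtain_subset_with_card_n)
  then obtain A B C D where ABCD: "F' = {A, B, C, D}" "A \<noteq> B" "A \<noteq> C" "A \<noteq> D" "B \<noteq> C" "B \<noteq> D" "C \<noteq> D"
    by (auto simp: eval_nat_numeral card_Suc_eq)
  have "A \<in> missed ` K" "B \<in> missed ` K" "C \<in> missed ` K" "D \<in> missed ` K"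
    using F(1) F'(1) ABCD(1) by auto
  then obtain k1 k2 k3 k4 where k: "k1 \<in> K" "k2 \<in> K" "k3 \<in> K" "k4 \<in> K"
    "A = missed k1" "B = missed k2" "C = missed k3" "D = missed k4"
    by (elim imageE) metis
  have "X \<inter> Y = {}" if "X \<in> F'" "Y \<in> F'" "X \<noteq> Y" for X Y
    using F(3) F'(1) that by (auto simp: pairwise_def disjnt_def)
  moreover have "X \<noteq> {}" if "X \<in> F'" for X using F(2) F'(1) that by blast
  ultimately have "nlc_width_le E 8 (K \<union> R)"
    using ABCD k by (intro width_four_disjoint[of k1 k2 k3 k4]) auto
  then show ?thesis by (rule nlc_width_le_mono) simp
qed

end

section \<open>Forbidden induced subgraphs and clique-width\<close>

text \<open>In cyclic order the hole is \<open>x\<close> followed by the path, so path positions are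
  shifted by one and both ends of the path are adjacent to position 0.\<close>

lemma chordal_no_hole:
  assumes "pair_graph G" "chordal G"
    and path: "induced_path (\<lambda>u v. (u, v) \<in> parcs G) (a # p @ [b])" and ne: "p \<noteq> []"
    and ab: "(x, a) \<in> parcs G" "(x, b) \<in> parcs G"
    and p: "\<And>z. z \<in> set p \<Longrightarrow> z \<noteq> x \<and> (x, z) \<notin> parcs G"
  shows False
proof -
  interpret G: pair_graph G by fact
  let ?E = "\<lambda>u v. (u, v) \<in> parcs G"
  have sym: "?E u v \<longleftrightarrow> ?E v u" for u v
    using G.pair_sym_arcs by (auto simp: symmetric_def dest: symD)
  have irrefl: "\<not> ?E u u" for u using G.pair_no_loops by fastforce
  have nth: "?E (q ! i) (q ! j) \<longleftrightarrow> j = Suc i \<or> i = Suc j"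
    if "induced_path ?E q" "i < length q" "j < length q" for q i j
    using that
  proof (induction ?E q arbitrary: i j rule: induced_path.induct)
    case (3 y z q)
    have 0: "?E y ((z # q) ! j) \<longleftrightarrow> j = 0" if "j < length (z # q)" for j
      using 3(2) that by (cases j) auto
    show ?case
      using 0[of "i - 1"] 0[of "j - 1"] 3 sym irrefl by (cases i; cases j) auto
  qed (use irrefl in auto)
  define q where "q = a # p @ [b]"
  define n where "n = length q"
  have n: "n \<ge> 3" using ne by (cases p) (auto simp: n_def q_def)
  have dq: "distinct (x # q)"
    using induced_path_distinct[OF path] p ab irrefl by (auto simp: q_def)
  have nth_q: "?E (q ! i) (q ! j) \<longleftrightarrow> j = Suc i \<or> i = Suc j" if "i < n" "j < n" for i j
    using nth[of q i j] path that by (simp add: q_def n_def)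
  have xq: "?E x (q ! j) \<longleftrightarrow> j = 0 \<or> Suc j = n" if j: "j < n" for j
  proof (cases "j = 0 \<or> Suc j = n")
    case True
    then show ?thesis using ab by (auto simp: q_def n_def nth_append)
  next
    case False
    then have "q ! j \<in> set p" using j by (cases j) (auto simp: q_def n_def nth_append)
    then show ?thesis using p False by blast
  qed
  have "q ! i \<in> pverts G" if "i < n" for i
  proof (cases "Suc i < n")
    case True
    then show ?thesis using nth_q[of i "Suc i"] that G.in_arcsD1 by blast
  next
    case False
    then have "Suc i = n" using that by simp
    then show ?thesis using xq[of i] that G.in_arcsD2 by blast
  qed
  moreover have "x \<in> pverts G" using ab(1) G.in_arcsD1 by blast
  ultimately have verts: "(x # q) ! i \<in> pverts G" if "i < Suc n" for i
    using that by (cases i) auto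
  have "\<not> induced_free (cycle_graph (Suc n)) G"
  proof (rule not_induced_free[OF assms(1), where g = "\<lambda>i. (x # q) ! i"])
    show "pair_wf_digraph (cycle_graph (Suc n))"
      by unfold_locales (auto simp: cycle_graph_def)
    show "inj_on (\<lambda>i. (x # q) ! i) (pverts (cycle_graph (Suc n)))"
      using dq by (intro inj_on_nth) (auto simp: cycle_graph_def n_def)
    show "(\<lambda>i. (x # q) ! i) ` pverts (cycle_graph (Suc n)) \<subseteq> pverts G"
      using verts by (auto simp: cycle_graph_def)
    fix i j assume "i \<in> pverts (cycle_graph (Suc n))" "j \<in> pverts (cycle_graph (Suc n))"
    then have ij: "i \<le> n" "j \<le> n" by (auto simp: cycle_graph_def)
    have "(i, j) \<in> parcs (cycle_graph (Suc n)) \<longleftrightarrow>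
        j = (if i = n then 0 else Suc i) \<or> i = (if j = n then 0 else Suc j)"
      using ij by (auto simp: cycle_graph_def)
    also have "\<dots> \<longleftrightarrow> ?E ((x # q) ! i) ((x # q) ! j)"
    proof (cases i)
      case 0
      then show ?thesis using xq[of "j - 1"] irrefl ij n by (cases j) auto
    next
      case (Suc i')
      then show ?thesis
        using xq[of i'] nth_q[of i' "j - 1"] sym[of "q ! i'" x] ij n by (cases j) auto
    qed
    finally show "(i, j) \<in> parcs (cycle_graph (Suc n)) \<longleftrightarrow> ((x # q) ! i, (x # q) ! j) \<in> parcs G" .
  qed
  moreover have "induced_free (cycle_graph (Suc n)) G"
    using assms(2) n by (auto simp: chordal_def)
  ultimately show False by blast
qed

section \<open>The forbidden graph in coordinates\<close>

abbreviation (input) copaw :: "(nat + nat + nat) pair_pre_digraph" where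
  "copaw \<equiv> disjoint_sum (path_graph 1) (complement (disjoint_sum (path_graph 1) (path_graph 3)))"

lemma pverts_copaw:
  "pverts copaw = {Inl 0, Inr (Inl 0), Inr (Inr 0), Inr (Inr (Suc 0)), Inr (Inr 2)}"
  by (auto simp: disjoint_sum_def complement_def path_graph_def)

lemma pverts_disjoint_sum:
  "Inl a \<in> pverts (disjoint_sum G H) \<longleftrightarrow> a \<in> pverts G"
  "Inr b \<in> pverts (disjoint_sum G H) \<longleftrightarrow> b \<in> pverts H"
  by (auto simp: disjoint_sum_def)

lemma parcs_complement:
  "(u, v) \<in> parcs (complement G) \<longleftrightarrow> u \<in> pverts G \<and> v \<in> pverts G \<and> u \<noteq> v \<and> (u, v) \<notin> parcs G"
  by (simp add: complement_def)

lemma parcs_disjoint_sum: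
  "(Inl a, Inl a') \<in> parcs (disjoint_sum G H) \<longleftrightarrow> (a, a') \<in> parcs G"
  "(Inr b, Inr b') \<in> parcs (disjoint_sum G H) \<longleftrightarrow> (b, b') \<in> parcs H"
  "(Inl a, Inr b) \<notin> parcs (disjoint_sum G H)"
  "(Inr b, Inl a) \<notin> parcs (disjoint_sum G H)"
  by (auto simp: disjoint_sum_def)

lemma pair_wf_digraph_copaw: "pair_wf_digraph copaw"
proof -
  have sum: "pair_wf_digraph (disjoint_sum G H)"
    if "pair_wf_digraph G" "pair_wf_digraph H"
    for G :: "'b pair_pre_digraph" and H :: "'c pair_pre_digraph"
    using that by (fastforce simp: pair_wf_digraph_def disjoint_sum_def)
  have "pair_wf_digraph (path_graph n)" for n
    by unfold_locales (auto simp: path_graph_def)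
  moreover have "pair_wf_digraph (complement G)" for G :: "'b pair_pre_digraph"
    by unfold_locales (auto simp: complement_def)
  ultimately show ?thesis by (intro sum)
qed

lemma copaw_free_no_copaw:
  assumes "pair_graph G" "induced_free copaw G"
    and e: "e \<in> pverts G" "(e, c) \<notin> parcs G" "(e, x) \<notin> parcs G" "(e, y) \<notin> parcs G" "(e, z) \<notin> parcs G"
    and paw: "(c, x) \<in> parcs G" "(c, y) \<in> parcs G" "(c, z) \<in> parcs G" "(y, z) \<in> parcs G"
      "(x, y) \<notin> parcs G" "(x, z) \<notin> parcs G"
  shows False
proof -
  interpret G: pair_graph G by fact
  let ?E = "\<lambda>u v. (u, v) \<in> parcs G"
  have sym: "?E u v \<longleftrightarrow> ?E v u" for u v
    using G.pair_sym_arcs by (auto simp: symmetric_def dest: symD)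
  have irrefl: "\<not> ?E u u" for u using G.pair_no_loops by fastforce
  \<comment> \<open>The summand \<open>P_1\<close> inside the complement becomes the vertex of
    degree 3. Of the path 0, 1, 2 the ends become adjacent, giving \<open>y\<close> and
    \<open>z\<close>, and the middle becomes the pendant \<open>x\<close>.\<close>
  define g :: "nat + nat + nat \<Rightarrow> 'a" where
    "g = case_sum (\<lambda>_. e) (case_sum (\<lambda>_. c) (\<lambda>i. if i = 0 then y else if i = 1 then x else z))"
  have g: "g (Inl 0) = e" "g (Inr (Inl 0)) = c" "g (Inr (Inr 0)) = y"
    "g (Inr (Inr (Suc 0))) = x" "g (Inr (Inr 2)) = z"
    by (auto simp: g_def)
  have "e \<noteq> c" "e \<noteq> x" "e \<noteq> y" "e \<noteq> z" "c \<noteq> x" "c \<noteq> y" "c \<noteq> z" "x \<noteq> y" "x \<noteq> z" "y \<noteq> z"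
    using e paw sym irrefl by blast+
  note ne = this this[symmetric]
  have "\<not> ?E c e" "\<not> ?E x e" "\<not> ?E y e" "\<not> ?E z e" "?E x c" "?E y c" "?E z c" "?E z y"
    "\<not> ?E y x" "\<not> ?E z x"
    using e paw sym by blast+
  note adj = this e paw irrefl
  have "c \<in> pverts G" "x \<in> pverts G" "y \<in> pverts G" "z \<in> pverts G"
    using paw G.in_arcsD1 G.in_arcsD2 by blast+
  note verts = this e(1)
  have "\<not> induced_free copaw G"
  proof (rule not_induced_free[OF assms(1), where g = g])
    show "pair_wf_digraph copaw" by (rule pair_wf_digraph_copaw)
    show "inj_on g (pverts copaw)" unfolding pverts_copaw using ne by (auto simp: g inj_on_def)
    show "g ` pverts copaw \<subseteq> pverts G"
      unfolding pverts_copaw using verts by (simp add: g)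
    have "\<forall>u\<in>pverts copaw. \<forall>v\<in>pverts copaw. (u, v) \<in> parcs copaw \<longleftrightarrow> (g u, g v) \<in> parcs G"
      unfolding pverts_copaw
      by (simp add: g adj parcs_disjoint_sum pverts_disjoint_sum parcs_complement path_graph_def)
    then show "(u, v) \<in> parcs copaw \<longleftrightarrow> (g u, g v) \<in> parcs G"
      if "u \<in> pverts copaw" "v \<in> pverts copaw" for u v
      using that by blast
  qed
  with assms(2) show False by blast
qed

text \<open>The width 540 of \<open>K \<union> R\<close> is doubled by the mark for \<open>K\<close>
  used to attach \<open>v\<close>, and tripled in passing to clique-width.\<close>

lemma chordal_copaw_free_clique_width:
  assumes G: "pair_graph G" "chordal G" "induced_free copaw G"
  shows "clique_width G \<le> 3240"
proof (cases "pverts G = {}")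
  case True
  then show ?thesis by (simp add: clique_width_def)
next
  case False
  interpret G: pair_graph G by fact
  define E where "E u v \<longleftrightarrow> (u, v) \<in> parcs G" for u v
  have sym: "E u v \<Longrightarrow> E v u" for u v
    using G.pair_sym_arcs by (auto simp: symmetric_def E_def dest: symD)
  have irrefl: "\<not> E u u" for u using G.pair_no_loops by (fastforce simp: E_def)
  interpret hole_free E
  proof
    fix a p b x
    assume "induced_path E (a # p @ [b])" "p \<noteq> []" "E x a" "E x b"
      "\<And>z. z \<in> set p \<Longrightarrow> z \<noteq> x \<and> \<not> E x z"
    then show False
      using chordal_no_hole[OF G(1,2), of a p b x] by (simp add: E_def[abs_def])
  qed (use sym irrefl in auto)
  obtain v where v: "simplicial (pverts G) v" using ex_simplicial[OF _ False] by auto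
  define K where "K = {u \<in> pverts G. E v u}"
  define R where "R = {u \<in> pverts G. u \<noteq> v \<and> \<not> E v u}"
  have verts: "pverts G = {v} \<union> (K \<union> R)" and vKR: "v \<notin> K \<union> R"
    using v irrefl by (auto simp: K_def R_def simplicial_def)
  interpret simplicial_split E K R v
  proof
    fix e c x y z
    assume "e \<in> insert v (K \<union> R)" "E c x" "E c y" "E c z" "E y z" "\<not> E x y" "\<not> E x z"
      "\<not> E e c" "\<not> E e x" "\<not> E e y" "\<not> E e z"
    then show False
      using copaw_free_no_copaw[OF G(1,3), of e c x y z] verts by (simp add: E_def)
  qed (use v in \<open>auto simp: K_def R_def simplicial_def\<close>)
  have "nlc_width_le E (540 * 2) ({v} \<union> (K \<union> R))"
  proof (rule nlc_width_le_union[where C = UNIV and c = "\<lambda>u. u \<in> K" and S = "\<lambda>_ q. q"])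
    have "nlc E 540 {v} (\<lambda>_. 0)" by (rule nlc.single) simp
    then show "nlc_width_le E 540 {v}" by (rule nlc_width_leI)
    fix u w assume "u \<in> {v}" "w \<in> K \<union> R"
    then show "E u w \<longleftrightarrow> w \<in> K" by (auto simp: K_def R_def)
  qed (use width_le vKR in auto)
  then obtain f where "nlc E 1080 (pverts G) f"
    unfolding nlc_width_le_def using verts by auto
  then obtain l where "cw_constructible 3240 (induced E (pverts G)) l"
    using nlc_imp_cw_constructible[of E 1080 "pverts G" f] sym irrefl by auto
  moreover have "induced E (pverts G) = G"
    by (intro pair_pre_digraph.equality)
      (auto simp: induced_def E_def dest: G.in_arcsD1 G.in_arcsD2)
  ultimately show ?thesis
    unfolding clique_width_def using False by (auto intro: Least_le)
qed

theorem theorem4: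
  shows "bounded_clique_width
    {G :: 'a pair_pre_digraph. pair_graph G \<and> chordal G \<and>
       induced_free
         (disjoint_sum (path_graph 1)
            (complement (disjoint_sum (path_graph 1) (path_graph 3)))) G}"
  unfolding bounded_clique_width_def using chordal_copaw_free_clique_width by blast

end
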